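(* Let $n\in\mathbb{Z}_{>0}$, let $q,t^{\frac12}\in\mathbb{C}^\times$, and let $\mathbf{1}_0,\varepsilon_0$ be the bosonic and fermionic symmetrizers acting on $\mathbb{C}[X]=\mathbb{C}[x_1^{\pm1},\ldots,x_n^{\pm1}]$ (defined in the context). Then $$\mathbf{1}_0\mathbb{C}[X]=\mathbb{C}[X]^{\mathrm{Bos}}=\mathbb{C}[X]^{S_n}\qquad\text{and}\qquad \varepsilon_0\mathbb{C}[X]=\mathbb{C}[X]^{\mathrm{Fer}}=A_\rho \mathbb{C}[X]^{S_n}.$$ Moreover, there are $\mathbb{C}[X]^{S_n}$-module isomorphisms $$\mathbb{C}[X]^{S_n}\to \mathbb{C}[X]^{\det},\ f\mapsto a_\rho f,\qquad\text{and}\qquad \mathbb{C}[X]^{\mathrm{Bos}}\to \mathbb{C}[X]^{\mathrm{Fer}},\ f\mapsto A_\rho f,$$ where $$a_\rho=\prod_{1\le i<j\le n}(x_j-x_i)\qquad\text{and}\qquad A_\rho=\prod_{1\le i<j\le n}(x_j-tx_i).$$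
   Context: Let $q,t^{\frac12}\in\mathbb{C}^\times=\mathbb{C}\setminus\{0\}$, $t=(t^{\frac12})^2$, and $\mathbb{C}[X]=\mathbb{C}[x_1^{\pm1},\ldots,x_n^{\pm1}]$. The symmetric group $S_n$ acts on $\mathbb{C}[X]$ by permuting the variables; $s_i$ is the transposition $(i,i+1)$, $\ell$ is the length function on $S_n$ and $w_0$ is the longest element. For $i\in\{1,\ldots,n-1\}$ define the operator $T_i:\mathbb{C}[X]\to\mathbb{C}[X]$ by $$T_if=-t^{-\frac12}f+(1+s_i)\left(\frac{t^{-\frac12}-t^{\frac12}x_i^{-1}x_{i+1}}{1-x_i^{-1}x_{i+1}}f\right).$$ For $w\in S_n$ with reduced word $w=s_{i_1}\cdots s_{i_\ell}$ put $T_w=T_{i_1}\cdots T_{i_\ell}$ (independent of the reduced word). Define $$\mathbf{1}_0=\sum_{w\in S_n}t^{\frac12(\ell(w)-\ell(w_0))}T_w,\qquad \varepsilon_0=\sum_{w\in S_n}(-t^{-\frac12})^{\ell(w)-\ell(w_0)}T_w .$$ Define subspaces of $\mathbb{C}[X]$ (conditions for all $i\in\{1,\ldots,n-1\}$): $\mathbb{C}[X]^{S_n}=\{f: s_if=f\}$, $\mathbb{C}[X]^{\det}=\{f: s_if=-f\}$, $\mathbb{C}[X]^{\mathrm{Bos}}=\{f: T_if=t^{\frac12}f\}$, $\mathbb{C}[X]^{\mathrm{Fer}}=\{f: T_if=-t^{-\frac12}f\}$.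
   Formalization: The formal theorem assumes in addition that the sum of t^{ℓ(w)} over w in S_n is nonzero, i.e. t is not a root of unity of order k with 2 ≤ k ≤ n; otherwise the claim fails (for n=2, t=-1, C[X]^Fer = C[X]^{S_2}, which is not (x_1+x_2)C[X]^{S_2}). *)

theory Defs
  imports
    Complex_Main
    "HOL-Library.Poly_Mapping"
    "HOL-Combinatorics.Permutations"
    "HOL-Computational_Algebra.Polynomial_Factorial"
begin

section \<open>Laurent polynomials\<close>

text \<open>
  A Laurent polynomial is a finitely supported function from exponent vectors to the
  coefficients, multiplied by convolution.  The type allows the variables \<open>X k\<close> for all
  \<open>k :: nat\<close>; the ring in the variables \<open>X 1, \<dots>, X n\<close> is the subset \<open>laurent n\<close>.
\<close>

type_synonym lpoly = "(nat \<Rightarrow>\<^sub>0 int) \<Rightarrow>\<^sub>0 complex"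

definition laurent :: "nat \<Rightarrow> lpoly set" where
  "laurent n = {f. \<forall>m\<in>Poly_Mapping.keys f. Poly_Mapping.keys m \<subseteq> {1..n}}"

definition const :: "complex \<Rightarrow> lpoly" where
  "const c = Poly_Mapping.single 0 c"

definition X :: "nat \<Rightarrow> lpoly" where
  "X i = Poly_Mapping.single (Poly_Mapping.single i 1) 1"

definition Xinv :: "nat \<Rightarrow> lpoly" where
  "Xinv i = Poly_Mapping.single (Poly_Mapping.single i (- 1)) 1"

lemma X_Xinv: "X i * Xinv i = 1"
  by (simp add: X_def Xinv_def mult_single flip: single_add)

section \<open>The action of the symmetric group\<close>

text \<open>
  For a permutation \<open>\<sigma>\<close>, the coefficient of \<open>act \<sigma> f\<close> at \<open>m\<close> is that of \<open>f\<close> at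
  \<open>m \<circ> \<sigma>\<close>, so that \<open>act \<sigma>\<close> is the ring automorphism with \<open>X i \<mapsto> X (\<sigma> i)\<close>.
\<close>

definition act :: "(nat \<Rightarrow> nat) \<Rightarrow> lpoly \<Rightarrow> lpoly" where
  "act \<sigma> f = Poly_Mapping.map_key (Poly_Mapping.map_key \<sigma>) f"

lemma map_key_surj_inj:
  assumes "bij \<sigma>"
  shows "inj (Poly_Mapping.map_key \<sigma> :: (nat \<Rightarrow>\<^sub>0 int) \<Rightarrow> _)"
proof (rule injI)
  fix p q :: "nat \<Rightarrow>\<^sub>0 int"
  assume "Poly_Mapping.map_key \<sigma> p = Poly_Mapping.map_key \<sigma> q"
  then have "Poly_Mapping.lookup p (\<sigma> k) = Poly_Mapping.lookup q (\<sigma> k)" for k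
    using assms by (metis bij_is_inj map_key.rep_eq comp_apply)
  then show "p = q"
    using assms by (intro poly_mapping_eqI) (metis bij_pointE)
qed

lemma lookup_act:
  assumes "bij \<sigma>"
  shows "Poly_Mapping.lookup (act \<sigma> f) m = Poly_Mapping.lookup f (Poly_Mapping.map_key \<sigma> m)"
  unfolding act_def using map_key_surj_inj[OF assms] by (simp add: map_key.rep_eq)

lemma map_key_inv:
  assumes "bij \<sigma>"
  shows "Poly_Mapping.map_key \<sigma> (Poly_Mapping.map_key (inv \<sigma>) m) = (m :: nat \<Rightarrow>\<^sub>0 int)"
    and "Poly_Mapping.map_key (inv \<sigma>) (Poly_Mapping.map_key \<sigma> m) = m"
  using assms
  by (auto intro!: poly_mapping_eqI
      simp: map_key.rep_eq bij_is_inj bij_imp_bij_inv inv_f_f bij_inv_eq_iff surj_f_inv_f bij_is_surj)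

lemma act_single:
  assumes "bij \<sigma>"
  shows "act \<sigma> (Poly_Mapping.single m c) = Poly_Mapping.single (Poly_Mapping.map_key (inv \<sigma>) m) c"
proof (rule poly_mapping_eqI)
  fix k
  have "m = Poly_Mapping.map_key \<sigma> k \<longleftrightarrow> Poly_Mapping.map_key (inv \<sigma>) m = k"
    using map_key_inv(1)[OF assms, of k] map_key_inv(2)[OF assms, of k]
      map_key_inv(1)[OF assms, of m] by auto
  then show "Poly_Mapping.lookup (act \<sigma> (Poly_Mapping.single m c)) k
      = Poly_Mapping.lookup (Poly_Mapping.single (Poly_Mapping.map_key (inv \<sigma>) m) c) k"
    by (simp add: lookup_act[OF assms] lookup_single when_def)
qed

lemma act_add: "bij \<sigma> \<Longrightarrow> act \<sigma> (f + g) = act \<sigma> f + act \<sigma> g"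
  by (simp add: act_def map_key_plus map_key_surj_inj)

lemma act_0 [simp]: "bij \<sigma> \<Longrightarrow> act \<sigma> 0 = 0"
  by (rule poly_mapping_eqI) (simp add: lookup_act)

lemma lpoly_induct [case_names single add]:
  fixes f :: lpoly
  assumes "\<And>m c. P (Poly_Mapping.single m c)" "\<And>f g. P f \<Longrightarrow> P g \<Longrightarrow> P (f + g)"
  shows "P f"
proof (induction f rule: Poly_Mapping.update_induct)
  case const
  show ?case using assms(1)[of 0 0] by simp
next
  case (update f a b)
  have "Poly_Mapping.update a b f = f + Poly_Mapping.single a b"
    using update(1)
    by (intro poly_mapping_eqI) (auto simp: lookup_update lookup_add lookup_single in_keys_iff)
  then show ?case using update assms by metis
qed

lemma act_mult:
  assumes "bij \<sigma>"
  shows "act \<sigma> (f * g) = act \<sigma> f * act \<sigma> g"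
proof (induction f rule: lpoly_induct)
  case (single m c)
  show ?case
  proof (induction g rule: lpoly_induct)
    case (single m' c')
    then show ?case
      using assms by (simp add: mult_single act_single map_key_plus bij_is_inj bij_imp_bij_inv)
  next
    case (add f g) then show ?case using assms by (simp add: distrib_left act_add)
  qed
next
  case (add f g) then show ?case using assms by (simp add: distrib_right act_add)
qed

lemma act_eq_0_iff:
  assumes "bij \<sigma>"
  shows "act \<sigma> f = 0 \<longleftrightarrow> f = 0"
proof
  assume *: "act \<sigma> f = 0"
  have "Poly_Mapping.lookup f m = Poly_Mapping.lookup (act \<sigma> f) (Poly_Mapping.map_key (inv \<sigma>) m)" for m
    by (simp add: lookup_act[OF assms] map_key_inv[OF assms])
  then show "f = 0" using * by (intro poly_mapping_eqI) simp
qed (use assms in simp)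

lemma act_X: "bij \<sigma> \<Longrightarrow> act \<sigma> (X i) = X (\<sigma> i)"
  unfolding X_def
  by (auto intro!: arg_cong[where f = "\<lambda>m. Poly_Mapping.single m 1"] poly_mapping_eqI
      simp: act_single map_key.rep_eq lookup_single when_def bij_is_inj bij_imp_bij_inv
        bij_inv_eq_iff split: if_splits)

abbreviation sref :: "nat \<Rightarrow> nat \<Rightarrow> nat" where
  "sref i \<equiv> transpose i (Suc i)"

text \<open>The extension of the action of \<open>sref i\<close> to the fraction field.\<close>

definition s_fract :: "nat \<Rightarrow> lpoly fract \<Rightarrow> lpoly fract" where
  "s_fract i z =
     (THE w. \<exists>a b. b \<noteq> 0 \<and> z = Fract a b \<and> w = Fract (act (sref i) a) (act (sref i) b))"

lemma s_fract_Fract: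
  assumes "b \<noteq> 0"
  shows "s_fract i (Fract a b) = Fract (act (sref i) a) (act (sref i) b)"
  unfolding s_fract_def
proof (rule the_equality)
  fix w
  assume "\<exists>a' b'. b' \<noteq> 0 \<and> Fract a b = Fract a' b' \<and> w = Fract (act (sref i) a') (act (sref i) b')"
  then obtain a' b' where *: "b' \<noteq> 0" "a * b' = a' * b"
    and w: "w = Fract (act (sref i) a') (act (sref i) b')"
    using assms by (auto simp: eq_fract)
  have "act (sref i) a * act (sref i) b' = act (sref i) a' * act (sref i) b"
    using *(2) by (simp flip: act_mult)
  then show "w = Fract (act (sref i) a) (act (sref i) b)"
    unfolding w using * assms by (simp add: eq_fract act_eq_0_iff)
qed (use assms in blast)

section \<open>The operators \<open>T\<close>\<close>

text \<open>
  The parameter \<open>th\<close> is the chosen square root of \<open>t = th\<^sup>2\<close>.  The defining formula of the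
  operator is read in the fraction field, as \<open>1 - Xinv i * X (Suc i)\<close> is not invertible; its
  value is a Laurent polynomial by \<open>hecke_T_fract\<close>.
\<close>

definition T_fract :: "complex \<Rightarrow> nat \<Rightarrow> lpoly \<Rightarrow> lpoly fract" where
  "T_fract th i f =
     (let g = to_fract (const (inverse th) - const th * Xinv i * X (Suc i))
              / to_fract (1 - Xinv i * X (Suc i)) * to_fract f
      in - to_fract (const (inverse th)) * to_fract f + (g + s_fract i g))"

definition hecke_T :: "complex \<Rightarrow> nat \<Rightarrow> lpoly \<Rightarrow> lpoly" where
  "hecke_T th i f = (THE h. to_fract h = T_fract th i f)"

lemma bij_sref: "bij (sref i)"
  by simp

lemma act_one: "bij \<sigma> \<Longrightarrow> act \<sigma> 1 = 1"
  using act_single[of \<sigma> 0 1] by (simp add: map_key_zero bij_is_inj bij_imp_bij_inv)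

lemma act_const: "bij \<sigma> \<Longrightarrow> act \<sigma> (const c) = const c"
  by (simp add: const_def act_single map_key_zero bij_is_inj bij_imp_bij_inv)

lemma act_diff: "bij \<sigma> \<Longrightarrow> act \<sigma> (f - g) = act \<sigma> f - act \<sigma> g"
  by (metis act_add add_diff_cancel_right' diff_add_cancel)

lemma act_Xinv:
  assumes "bij \<sigma>"
  shows "act \<sigma> (Xinv i) = Xinv (\<sigma> i)"
proof -
  have "X (\<sigma> i) * act \<sigma> (Xinv i) = 1"
    using act_mult[OF assms, of "X i" "Xinv i"] by (simp add: X_Xinv act_one assms act_X)
  then have "X (\<sigma> i) * act \<sigma> (Xinv i) = X (\<sigma> i) * Xinv (\<sigma> i)"
    by (simp only: X_Xinv)
  moreover have "X (\<sigma> i) \<noteq> 0"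
    using X_Xinv[of "\<sigma> i"] by auto
  ultimately show ?thesis
    by simp
qed

lemma Y_neq_1: "1 - Xinv i * X (Suc i) \<noteq> 0"
proof
  assume "1 - Xinv i * X (Suc i) = 0"
  then have "X i * Xinv i * X (Suc i) = X i"
    by (simp add: mult.assoc)
  then have "X i = X (Suc i)"
    by (simp add: X_Xinv)
  then have "Poly_Mapping.lookup (X i) (Poly_Mapping.single i 1)
      = Poly_Mapping.lookup (X (Suc i)) (Poly_Mapping.single i 1)"
    by simp
  moreover have "Poly_Mapping.single (Suc i) (1::int) \<noteq> Poly_Mapping.single i 1"
  proof
    assume "Poly_Mapping.single (Suc i) (1::int) = Poly_Mapping.single i 1"
    then have "Poly_Mapping.lookup (Poly_Mapping.single (Suc i) (1::int)) i
        = Poly_Mapping.lookup (Poly_Mapping.single i (1::int)) i"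
      by simp
    then show False by (simp add: lookup_single)
  qed
  ultimately show False
    by (simp add: X_def lookup_single)
qed

lemma demazure_dvd: "1 - Xinv i * X (Suc i) dvd f - act (sref i) f"
proof (induction f rule: lpoly_induct)
  case (add f g)
  have "f + g - act (sref i) (f + g) = (f - act (sref i) f) + (g - act (sref i) g)"
    by (simp add: act_add)
  then show ?case using add by (metis dvd_add)
next
  case (single m c)
  define Y where "Y = Xinv i * X (Suc i)"
  define e where "e = Poly_Mapping.single i (- 1) + Poly_Mapping.single (Suc i) (1::int)"
  have Y: "Y = Poly_Mapping.single e 1"
    by (simp add: Y_def X_def Xinv_def mult_single e_def)
  have step: "1 - Y dvd Poly_Mapping.single m c - Poly_Mapping.single (m + (\<Sum>j<k. e)) c"
    for k :: nat and m
  proof (induction k)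
    case (Suc k)
    have "Poly_Mapping.single (m + (\<Sum>j<k. e)) c - Poly_Mapping.single (m + (\<Sum>j<Suc k. e)) c
        = (1 - Y) * Poly_Mapping.single (m + (\<Sum>j<k. e)) c"
      by (simp add: Y left_diff_distrib mult_single add_ac del: sum_constant)
    then have "1 - Y dvd Poly_Mapping.single (m + (\<Sum>j<k. e)) c
        - Poly_Mapping.single (m + (\<Sum>j<Suc k. e)) c"
      by simp
    from dvd_add[OF Suc.IH this] show ?case by simp
  qed simp
  let ?m' = "Poly_Mapping.map_key (sref i) m"
  have lk: "Poly_Mapping.lookup (\<Sum>j<k. e) l = int k * Poly_Mapping.lookup e l" for k l
    by (induction k) (auto simp: lookup_add algebra_simps simp del: sum_constant)
  have le: "Poly_Mapping.lookup e l = (if l = i then - 1 else if l = Suc i then 1 else 0)" for l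
    by (auto simp: e_def lookup_add lookup_single when_def)
  have lm: "Poly_Mapping.lookup ?m' l = Poly_Mapping.lookup m (sref i l)" for l
    by (simp add: map_key.rep_eq bij_is_inj)
  have s: "act (sref i) (Poly_Mapping.single m c) = Poly_Mapping.single ?m' c"
    by (simp add: act_single)
  let ?d = "Poly_Mapping.lookup m i - Poly_Mapping.lookup m (Suc i)"
  show ?case
  proof (cases "?d \<ge> 0")
    case True
    then have "?m' = m + (\<Sum>j<nat ?d. e)"
      by (intro poly_mapping_eqI) (auto simp: lookup_add lk le lm transpose_def simp del: sum_constant)
    then show ?thesis using step[of m "nat ?d"] by (simp add: s Y_def)
  next
    case False
    then have "m = ?m' + (\<Sum>j<nat (- ?d). e)"
      by (intro poly_mapping_eqI) (auto simp: lookup_add lk le lm transpose_def simp del: sum_constant)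
    then have "1 - Y dvd Poly_Mapping.single ?m' c - Poly_Mapping.single m c"
      using step[of ?m' "nat (- ?d)"] by simp
    then show ?thesis by (metis s Y_def dvd_minus_iff minus_diff_eq)
  qed
qed

lemma hecke_T_fract: "to_fract (hecke_T th i f) = T_fract th i f"
proof -
  define Y where "Y = Xinv i * X (Suc i)"
  define Y' where "Y' = Xinv (Suc i) * X i"
  define a where "a = const (inverse th)"
  define b where "b = const th"
  have YY: "Y * Y' = 1"
  proof -
    have "Y * Y' = (X i * Xinv i) * (X (Suc i) * Xinv (Suc i))"
      by (simp only: Y_def Y'_def mult_ac)
    then show ?thesis by (simp only: X_Xinv mult_1_right)
  qed
  have nz: "1 - Y \<noteq> 0" using Y_neq_1 by (simp add: Y_def)
  have nz': "1 - Y' \<noteq> 0"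
    using nz YY by (metis eq_iff_diff_eq_0 mult_1_right)
  obtain d where d: "f - act (sref i) f = (1 - Y) * d"
    using demazure_dvd[of i f] by (auto simp: Y_def dvd_def)
  define u where "u = (a - b * Y) * d + (a + b) * act (sref i) f"
  have aY: "act (sref i) (a - b * Y) = a - b * Y'" "act (sref i) (1 - Y) = 1 - Y'"
    by (simp_all add: act_diff act_mult act_const act_one act_X act_Xinv a_def b_def Y_def Y'_def)
  have g: "to_fract (a - b * Y) / to_fract (1 - Y) * to_fract f = Fract ((a - b * Y) * f) (1 - Y)"
    using nz by (simp add: to_fract_def divide_fract)
  have sg: "s_fract i (Fract ((a - b * Y) * f) (1 - Y))
      = Fract ((a - b * Y') * act (sref i) f) (1 - Y')"
    using nz by (simp add: s_fract_Fract act_mult aY)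
  have "Fract ((a - b * Y) * f) (1 - Y) + Fract ((a - b * Y') * act (sref i) f) (1 - Y')
      = to_fract u"
  proof -
    have "Fract ((a - b * Y') * act (sref i) f) (1 - Y')
        = Fract ((b - a * Y) * act (sref i) f) (1 - Y)"
    proof -
      have "(a - b * Y') * (1 - Y) = (b - a * Y) * (1 - Y')"
      proof -
        have "(a - b * Y') * (1 - Y) = a - b * Y' - a * Y + b * (Y * Y')"
          by (simp add: algebra_simps)
        moreover have "(b - a * Y) * (1 - Y') = b - a * Y - b * Y' + a * (Y * Y')"
          by (simp add: algebra_simps)
        ultimately show ?thesis by (simp add: YY)
      qed
      then have "(a - b * Y') * act (sref i) f * (1 - Y) = (b - a * Y) * act (sref i) f * (1 - Y')"
      proof -
        assume *: "(a - b * Y') * (1 - Y) = (b - a * Y) * (1 - Y')"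
        have "(a - b * Y') * act (sref i) f * (1 - Y) = (a - b * Y') * (1 - Y) * act (sref i) f"
          by (simp only: mult_ac)
        also have "\<dots> = (b - a * Y) * act (sref i) f * (1 - Y')"
          unfolding * by (simp only: mult_ac)
        finally show ?thesis .
      qed
      then show ?thesis using nz nz' by (simp add: eq_fract)
    qed
    moreover have "(a - b * Y) * f + (b - a * Y) * act (sref i) f = u * (1 - Y)"
    proof -
      have "(a - b * Y) * f + (b - a * Y) * act (sref i) f
          = (a - b * Y) * (f - act (sref i) f) + (a + b) * (1 - Y) * act (sref i) f"
        by (simp add: algebra_simps)
      also have "\<dots> = u * (1 - Y)"
        unfolding d u_def by (simp add: algebra_simps)
      finally show ?thesis .
    qed
    moreover have "Fract ((a - b * Y) * f) (1 - Y) + Fract ((b - a * Y) * act (sref i) f) (1 - Y)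
        = Fract (((a - b * Y) * f + (b - a * Y) * act (sref i) f) * (1 - Y)) ((1 - Y) * (1 - Y))"
      using add_fract[OF nz nz] by (simp only: distrib_right)
    moreover have "Fract (u * (1 - Y) * (1 - Y)) ((1 - Y) * (1 - Y)) = to_fract u"
      using nz by (simp add: to_fract_def eq_fract mult.assoc)
    ultimately show ?thesis by simp
  qed
  moreover have "const (inverse th) - const th * Xinv i * X (Suc i) = a - b * Y"
    by (simp add: a_def b_def Y_def mult.assoc)
  ultimately have "T_fract th i f = - to_fract a * to_fract f + to_fract u"
    unfolding T_fract_def Let_def by (simp only: g sg flip: a_def Y_def)
  then have "T_fract th i f = to_fract (- a * f + u)"
    by simp
  then have "\<exists>!h. to_fract h = T_fract th i f" by (metis to_fract_eq_iff)
  then show ?thesis unfolding hecke_T_def by (rule theI')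
qed

section \<open>Words, length, and the symmetrizers\<close>

text \<open>
  A word \<open>[i\<^sub>1, \<dots>, i\<^sub>k]\<close> stands for the product \<open>sref i\<^sub>1 \<circ> \<dots> \<circ> sref i\<^sub>k\<close>.  The elements of
  \<open>S\<^sub>n\<close> are the \<open>w\<close> with \<open>w permutes {1..n}\<close>, and \<open>sref i\<close> is a generator for \<open>1 \<le> i < n\<close>.
\<close>

definition word_perm :: "nat list \<Rightarrow> nat \<Rightarrow> nat" where
  "word_perm is = foldr (\<lambda>i p. sref i \<circ> p) is id"

definition perm_length :: "nat \<Rightarrow> (nat \<Rightarrow> nat) \<Rightarrow> nat" where
  "perm_length n w = (LEAST k. \<exists>is. set is \<subseteq> {1..<n} \<and> word_perm is = w \<and> length is = k)"

definition reduced_word :: "nat \<Rightarrow> (nat \<Rightarrow> nat) \<Rightarrow> nat list \<Rightarrow> bool" where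
  "reduced_word n w is \<longleftrightarrow>
     set is \<subseteq> {1..<n} \<and> word_perm is = w \<and> length is = perm_length n w"

definition longest :: "nat \<Rightarrow> nat \<Rightarrow> nat" where
  "longest n = (ARG_MAX (perm_length n) w. w permutes {1..n})"

definition T_word :: "complex \<Rightarrow> nat list \<Rightarrow> lpoly \<Rightarrow> lpoly" where
  "T_word th is = foldr (\<lambda>i F. hecke_T th i \<circ> F) is id"

text \<open>The operator does not depend on the choice of the reduced word.\<close>

definition T_perm :: "complex \<Rightarrow> nat \<Rightarrow> (nat \<Rightarrow> nat) \<Rightarrow> lpoly \<Rightarrow> lpoly" where
  "T_perm th n w = T_word th (SOME is. reduced_word n w is)"

definition bos_symmetrizer :: "complex \<Rightarrow> nat \<Rightarrow> lpoly \<Rightarrow> lpoly" where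
  "bos_symmetrizer th n f =
     (\<Sum>w | w permutes {1..n}.
        const (th powi (int (perm_length n w) - int (perm_length n (longest n)))) * T_perm th n w f)"

definition fer_symmetrizer :: "complex \<Rightarrow> nat \<Rightarrow> lpoly \<Rightarrow> lpoly" where
  "fer_symmetrizer th n f =
     (\<Sum>w | w permutes {1..n}.
        const ((- inverse th) powi (int (perm_length n w) - int (perm_length n (longest n))))
          * T_perm th n w f)"

text \<open>
  The Poincare polynomial of \<open>S\<^sub>n\<close>.  The bosonic symmetrizer acts on bosonic elements by a unit
  times its value at \<open>t\<close>.  If it vanishes at \<open>t\<close>, then the image of the bosonic symmetrizer is a
  proper subspace of the bosonic space: for \<open>n = 2\<close> and \<open>t = - 1\<close> this image consists of the
  multiples of \<open>X 1 + X 2\<close> by symmetric elements, while \<open>1\<close> is bosonic.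
\<close>

definition poincare :: "nat \<Rightarrow> complex \<Rightarrow> complex" where
  "poincare n t = (\<Sum>w | w permutes {1..n}. t ^ perm_length n w)"

section \<open>Subspaces and module isomorphisms\<close>

definition lpoly_sym :: "nat \<Rightarrow> lpoly set" where
  "lpoly_sym n = {f \<in> laurent n. \<forall>i\<in>{1..<n}. act (sref i) f = f}"

definition lpoly_det :: "nat \<Rightarrow> lpoly set" where
  "lpoly_det n = {f \<in> laurent n. \<forall>i\<in>{1..<n}. act (sref i) f = - f}"

definition lpoly_bos :: "complex \<Rightarrow> nat \<Rightarrow> lpoly set" where
  "lpoly_bos th n = {f \<in> laurent n. \<forall>i\<in>{1..<n}. hecke_T th i f = const th * f}"

definition lpoly_fer :: "complex \<Rightarrow> nat \<Rightarrow> lpoly set" where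
  "lpoly_fer th n = {f \<in> laurent n. \<forall>i\<in>{1..<n}. hecke_T th i f = - const (inverse th) * f}"

definition a_rho :: "nat \<Rightarrow> lpoly" where
  "a_rho n = (\<Prod>(i, j) | 1 \<le> i \<and> i < j \<and> j \<le> n. X j - X i)"

definition A_rho :: "complex \<Rightarrow> nat \<Rightarrow> lpoly" where
  "A_rho t n = (\<Prod>(i, j) | 1 \<le> i \<and> i < j \<and> j \<le> n. X j - const t * X i)"

definition submodule_over :: "'a::comm_ring_1 set \<Rightarrow> 'a set \<Rightarrow> bool" where
  "submodule_over R M \<longleftrightarrow>
     0 \<in> M \<and> (\<forall>f\<in>M. \<forall>g\<in>M. f + g \<in> M) \<and> (\<forall>f\<in>M. - f \<in> M) \<and> (\<forall>r\<in>R. \<forall>f\<in>M. r * f \<in> M)"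

text \<open>Both modules are subsets of an ambient ring containing \<open>R\<close>, with \<open>R\<close> acting by multiplication.\<close>

definition module_iso :: "'a::comm_ring_1 set \<Rightarrow> 'a set \<Rightarrow> 'a set \<Rightarrow> ('a \<Rightarrow> 'a) \<Rightarrow> bool" where
  "module_iso R M N \<phi> \<longleftrightarrow>
     submodule_over R M \<and> submodule_over R N \<and> bij_betw \<phi> M N \<and>
     (\<forall>f\<in>M. \<forall>g\<in>M. \<phi> (f + g) = \<phi> f + \<phi> g) \<and> (\<forall>r\<in>R. \<forall>f\<in>M. \<phi> (r * f) = r * \<phi> f)"

end

(* Clearing the denominator of the operator turns the bosonic condition into s_i f = f, and the
   fermionic one into (X i - t X (i+1)) f = (X (i+1) - t X i) s_i f.

   The product A_rho satisfies the fermionic condition, so f * w(A_rho) = A_rho * w(f) for every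
   permutation w and every fermionic f.  Substituting X (i+1) = t X i shows that X (i+1) - t X i
   divides f if t^2 is not 1; if t = 1, then f is antisymmetric and the same holds.  The case t = -1
   is excluded by the nonvanishing of the Poincare polynomial.  As X j - t X i generates the kernel
   of the substitution X j = t X i, it is prime; the permutations w show that every factor of A_rho
   divides f, hence A_rho divides f, with an invariant quotient.  The determinant case is t = 1.

   Multiplication by T_i permutes the summands of a symmetrizer up to the quadratic relation, by the
   braid relations and Matsumoto's theorem.  So the images consist of eigenvectors of all T_i, and
   on these eigenvectors the symmetrizers act by a unit times the Poincare polynomial at t or
   1/t. *)

theory Submission
  imports Defs
begin

section \<open>Lengths and reduced words\<close>

declare One_nat_def [simp del]

section \<open>Inversions and their change under adjacent transpositions\<close>

definition inversions :: "nat \<Rightarrow> (nat \<Rightarrow> nat) \<Rightarrow> (nat \<times> nat) set" where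
  "inversions n v = {(a, b). a \<in> {1..n} \<and> b \<in> {1..n} \<and> a < b \<and> v b < v a}"

lemma finite_inversions: "finite (inversions n v)"
  by (rule finite_subset[of _ "{1..n} \<times> {1..n}"]) (auto simp: inversions_def)

text \<open>Apart from \<open>(i, Suc i)\<close>, every pair \<open>a < b\<close> keeps its order
  under \<open>sref i\<close>, so its inversions are only relabelled; the ascent at \<open>i\<close>
  becomes the one new inversion.\<close>

lemma mem_inversions_sref:
  assumes "i \<in> {1..<n}" "v i < v (Suc i)"
  shows "(a, b) \<in> inversions n (v \<circ> sref i) \<longleftrightarrow>
    (a, b) = (i, Suc i) \<or> (sref i a, sref i b) \<in> inversions n v"
  using assms unfolding inversions_def transpose_def by auto

lemma inversions_sref:
  assumes "i \<in> {1..<n}" "v i < v (Suc i)"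
  shows "inversions n (v \<circ> sref i)
    = insert (i, Suc i) (map_prod (sref i) (sref i) ` inversions n v)"
proof -
  have "(a, b) \<in> map_prod (sref i) (sref i) ` inversions n v
      \<longleftrightarrow> (sref i a, sref i b) \<in> inversions n v" for a b
    by (force simp: image_iff)
  then show ?thesis using mem_inversions_sref[OF assms] by auto
qed

lemma card_inversions_sref:
  assumes "i \<in> {1..<n}" "v i < v (Suc i)"
  shows "card (inversions n (v \<circ> sref i)) = Suc (card (inversions n v))"
proof -
  have "inj (map_prod (sref i) (sref i))"
    by (intro prod.inj_map) (simp_all add: bij_is_inj)
  moreover have "(i, Suc i) \<notin> map_prod (sref i) (sref i) ` inversions n v"
    by (auto simp: inversions_def transpose_def split: if_splits)
  ultimately show ?thesis
    unfolding inversions_sref[OF assms]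
    by (simp add: card_image finite_inversions inj_on_subset[OF _ subset_UNIV])
qed

text \<open>The inverse is used because left multiplication of \<open>w\<close> by
  \<open>sref i\<close>, which prepends a letter to a word, becomes precomposition of
  \<open>inv w\<close> with \<open>sref i\<close>.\<close>

definition ninv :: "nat \<Rightarrow> (nat \<Rightarrow> nat) \<Rightarrow> nat" where
  "ninv n w = card (inversions n (inv w))"

lemma sref_permutes: "i \<in> {1..<n} \<Longrightarrow> sref i permutes {1..n}"
  by (intro permutes_swap_id) auto

lemma sref_comp_permutes:
  "i \<in> {1..<n} \<Longrightarrow> w permutes {1..n} \<Longrightarrow> sref i \<circ> w permutes {1..n}"
  by (rule permutes_compose[OF _ sref_permutes])

lemma inv_sref_comp: "w permutes {1..n} \<Longrightarrow> inv (sref i \<circ> w) = inv w \<circ> sref i"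
  by (simp add: o_inv_distrib permutes_bij)

lemma sref_sref_comp: "sref i \<circ> (sref i \<circ> w) = w"
  by (auto simp: fun_eq_iff)

lemma ninv_ascent:
  assumes "w permutes {1..n}" "i \<in> {1..<n}" "inv w i < inv w (Suc i)"
  shows "ninv n (sref i \<circ> w) = Suc (ninv n w)"
  using card_inversions_sref[OF assms(2,3)] by (simp add: ninv_def inv_sref_comp[OF assms(1)])

lemma ninv_descent:
  assumes "w permutes {1..n}" "i \<in> {1..<n}" "inv w (Suc i) < inv w i"
  shows "ninv n w = Suc (ninv n (sref i \<circ> w))"
  using ninv_ascent[OF sref_comp_permutes[OF assms(2,1)] assms(2)] assms(3)
  by (simp add: inv_sref_comp[OF assms(1)] sref_sref_comp)

lemma ascent_or_descent:
  assumes "w permutes {1..n}"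
  obtains "inv w i < inv w (Suc i)" | "inv w (Suc i) < inv w i"
  using permutes_inj[OF permutes_inv[OF assms]] by (metis inj_eq n_not_Suc_n nat_neq_iff)

text \<open>With no descent, \<open>inv w\<close> increases on \<open>{1..n}\<close> from a value
  that is at least 1, so \<open>k \<le> inv w k\<close> there; a permutation with this property is
  the identity.\<close>

lemma no_descent_imp_id:
  assumes w: "w permutes {1..n}" and asc: "\<And>i. i \<in> {1..<n} \<Longrightarrow> inv w i < inv w (Suc i)"
  shows "w = id"
proof -
  have p: "inv w permutes {1..n}" by (rule permutes_inv[OF w])
  have "k \<le> inv w k" if "k \<in> {1..n}" for k
    using that
  proof (induction k)
    case (Suc k)
    show ?case
    proof (cases "k = 0")
      case True
      then show ?thesis using permutes_in_image[OF p, of 1] Suc.prems by (auto simp: One_nat_def)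
    next
      case False
      then show ?thesis using Suc asc[of k] by auto
    qed
  qed simp
  then have "inv w = id" by (intro permutes_natset_ge[OF p]) blast
  then show ?thesis using w by (metis inv_id permutes_inv_inv)
qed

section \<open>Words, and length as the number of inversions\<close>

lemma word_perm_simps [simp]:
  "word_perm [] = id" "word_perm (i # is) = sref i \<circ> word_perm is"
  by (simp_all add: word_perm_def)

lemma word_perm_permutes: "set is \<subseteq> {1..<n} \<Longrightarrow> word_perm is permutes {1..n}"
  by (induction "is") (auto simp: permutes_id sref_comp_permutes simp del: o_apply)

lemma ninv_id: "ninv n id = 0"
proof -
  have "inversions n id = {}" by (auto simp: inversions_def)
  then show ?thesis by (simp add: ninv_def)
qed

text \<open>Each letter changes the number of inversions by exactly one, up or down.\<close>

lemma ninv_word_perm_le: "set is \<subseteq> {1..<n} \<Longrightarrow> ninv n (word_perm is) \<le> length is"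
proof (induction "is")
  case (Cons i "is")
  have w: "word_perm is permutes {1..n}" using Cons.prems word_perm_permutes by simp
  have i: "i \<in> {1..<n}" using Cons.prems by simp
  show ?case
    using ascent_or_descent[OF w, of i] ninv_ascent[OF w i] ninv_descent[OF w i] Cons
    by (cases rule: ascent_or_descent[OF w, of i]) (auto simp del: o_apply)
qed (simp add: ninv_id)

text \<open>Bubble sort: each descent that is removed lowers \<open>ninv\<close> by one, and a
  permutation without descents is the identity, with the empty word.\<close>

lemma ex_word_of_length_ninv:
  "w permutes {1..n} \<Longrightarrow> \<exists>is. set is \<subseteq> {1..<n} \<and> word_perm is = w \<and> length is = ninv n w"
proof (induction "ninv n w" arbitrary: w rule: less_induct)
  case less
  show ?case
  proof (cases "\<exists>i\<in>{1..<n}. inv w (Suc i) < inv w i")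
    case True
    then obtain i where i: "i \<in> {1..<n}" "inv w (Suc i) < inv w i" by blast
    note d = ninv_descent[OF less.prems i]
    obtain "is" where "set is \<subseteq> {1..<n}" "word_perm is = sref i \<circ> w" "length is = ninv n (sref i \<circ> w)"
      using less.hyps[of "sref i \<circ> w"] d sref_comp_permutes[OF i(1) less.prems] by auto
    then show ?thesis using i d by (intro exI[of _ "i # is"]) (simp add: sref_sref_comp)
  next
    case False
    then have "w = id"
      using no_descent_imp_id[OF less.prems] ascent_or_descent[OF less.prems] by metis
    then show ?thesis by (intro exI[of _ "[]"]) (simp add: ninv_id)
  qed
qed

lemma perm_length_eq_ninv:
  assumes "w permutes {1..n}"
  shows "perm_length n w = ninv n w"
  unfolding perm_length_def
  by (rule Least_equality) (use ex_word_of_length_ninv[OF assms] ninv_word_perm_le in auto)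

lemma perm_length_ascent:
  assumes "w permutes {1..n}" "i \<in> {1..<n}" "inv w i < inv w (Suc i)"
  shows "perm_length n (sref i \<circ> w) = Suc (perm_length n w)"
  using ninv_ascent[OF assms] assms by (simp add: perm_length_eq_ninv sref_comp_permutes)

lemma ex_reduced_word: "w permutes {1..n} \<Longrightarrow> \<exists>is. reduced_word n w is"
  using ex_word_of_length_ninv by (fastforce simp: reduced_word_def perm_length_eq_ninv)

section \<open>Reduced words\<close>

lemma reduced_word_iff:
  "reduced_word n w is \<longleftrightarrow> set is \<subseteq> {1..<n} \<and> word_perm is = w \<and> length is = ninv n w"
  using word_perm_permutes[of "is" n] by (auto simp: reduced_word_def perm_length_eq_ninv)

lemma reduced_word_permutes: "reduced_word n w is \<Longrightarrow> w permutes {1..n}"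
  using word_perm_permutes by (auto simp: reduced_word_iff)

lemma reduced_word_ConsD:
  assumes "reduced_word n w (i # is)"
  shows "i \<in> {1..<n}" "inv w (Suc i) < inv w i" "reduced_word n (sref i \<circ> w) is"
proof -
  have w: "w permutes {1..n}" using assms by (rule reduced_word_permutes)
  have *: "set is \<subseteq> {1..<n}" "word_perm is = sref i \<circ> w" "ninv n w = Suc (length is)"
    using assms by (auto simp: reduced_word_iff sref_sref_comp)
  show i: "i \<in> {1..<n}" using assms by (simp add: reduced_word_iff)
  have le: "ninv n (sref i \<circ> w) \<le> length is" using ninv_word_perm_le[OF *(1)] *(2) by simp
  \<comment> \<open>An ascent would give \<open>sref i \<circ> w\<close> more inversions than the
    word \<open>is\<close> has letters.\<close>
  show d: "inv w (Suc i) < inv w i"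
    using ascent_or_descent[OF w, of i] ninv_ascent[OF w i] le *(3) by fastforce
  show "reduced_word n (sref i \<circ> w) is"
    using ninv_descent[OF w i d] * by (simp add: reduced_word_iff)
qed

lemma reduced_word_Cons:
  assumes "w permutes {1..n}" "i \<in> {1..<n}" "inv w (Suc i) < inv w i" "reduced_word n (sref i \<circ> w) is"
  shows "reduced_word n w (i # is)"
  using assms ninv_descent[OF assms(1-3)] by (simp add: reduced_word_iff sref_sref_comp)

text \<open>\<open>inv w\<close> decreases on the three positions \<open>i\<close>,
  \<open>Suc i\<close>, \<open>Suc (Suc i)\<close>, so the longest element of the subgroup generated
  by the two transpositions splits off on the left, and the rest \<open>w'\<close> is shorter by
  three.\<close>

lemma ex_reduced_word_braid:
  assumes w: "w permutes {1..n}" and i: "i \<in> {1..<n}" "Suc i \<in> {1..<n}"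
    and d: "inv w (Suc i) < inv w i" "inv w (Suc (Suc i)) < inv w (Suc i)"
  obtains z where "reduced_word n w (i # Suc i # i # z)" "reduced_word n w (Suc i # i # Suc i # z)"
proof -
  let ?s = "sref i" and ?r = "sref (Suc i)"
  define w' where "w' = ?s \<circ> (?r \<circ> (?s \<circ> w))"
  have braid: "w' = ?r \<circ> (?s \<circ> (?r \<circ> w))"
    by (auto simp: w'_def fun_eq_iff transpose_def)
  note p = sref_comp_permutes[OF i(1)] sref_comp_permutes[OF i(2)]
  have e: "inv (?s \<circ> v) = inv v \<circ> ?s" "inv (?r \<circ> v) = inv v \<circ> ?r" if "v permutes {1..n}" for v
    using that by (simp_all only: inv_sref_comp)
  have "w' permutes {1..n}" unfolding w'_def using w p by (simp del: o_apply)
  then obtain z where z: "reduced_word n w' z" using ex_reduced_word by blast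
  have "reduced_word n w (i # Suc i # i # z)"
    using d z[unfolded w'_def] w p i
    by (intro reduced_word_Cons) (simp_all add: e del: o_apply, simp_all)
  moreover have "reduced_word n w (Suc i # i # Suc i # z)"
    using d z[unfolded braid] w p i
    by (intro reduced_word_Cons) (simp_all add: e del: o_apply, simp_all)
  ultimately show ?thesis using that by blast
qed

text \<open>The letters act on disjoint positions, so removing one descent leaves the other in
  place.\<close>

lemma ex_reduced_word_commute:
  assumes w: "w permutes {1..n}" and i: "i \<in> {1..<n}" "j \<in> {1..<n}" "Suc i < j"
    and d: "inv w (Suc i) < inv w i" "inv w (Suc j) < inv w j"
  obtains z where "reduced_word n w (i # j # z)" "reduced_word n w (j # i # z)"
proof -
  let ?s = "sref i" and ?r = "sref j"
  define w' where "w' = ?r \<circ> (?s \<circ> w)"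
  have comm: "w' = ?s \<circ> (?r \<circ> w)"
    using i by (auto simp: w'_def fun_eq_iff transpose_def)
  note p = sref_comp_permutes[OF i(1)] sref_comp_permutes[OF i(2)]
  have e: "inv (?s \<circ> v) = inv v \<circ> ?s" "inv (?r \<circ> v) = inv v \<circ> ?r" if "v permutes {1..n}" for v
    using that by (simp_all only: inv_sref_comp)
  have "w' permutes {1..n}" unfolding w'_def using w p by (simp del: o_apply)
  then obtain z where z: "reduced_word n w' z" using ex_reduced_word by blast
  have "reduced_word n w (i # j # z)"
    using d z[unfolded w'_def] w p i
    by (intro reduced_word_Cons) (simp_all add: e del: o_apply, simp_all)
  moreover have "reduced_word n w (j # i # z)"
    using d z[unfolded comm] w p i
    by (intro reduced_word_Cons) (simp_all add: e del: o_apply, simp_all)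
  ultimately show ?thesis using that by blast
qed

text \<open>Matsumoto's theorem, by induction on the length: if two reduced words of \<open>w\<close> start with
  different letters, then \<open>w\<close> also has reduced words starting with both sides of the braid relation
  of these letters.\<close>

lemma matsumoto:
  fixes F :: "nat \<Rightarrow> 'a \<Rightarrow> 'a"
  defines "prd \<equiv> \<lambda>is. foldr (\<lambda>i G. F i \<circ> G) is id"
  assumes comm: "\<And>i j. Suc i < j \<Longrightarrow> F i \<circ> F j = F j \<circ> F i"
    and braid: "\<And>i. F i \<circ> F (Suc i) \<circ> F i = F (Suc i) \<circ> F i \<circ> F (Suc i)"
  shows "reduced_word n w u \<Longrightarrow> reduced_word n w v \<Longrightarrow> prd u = prd v"
proof (induction "length u" arbitrary: u v w rule: less_induct)
  case less
  have len: "length u = length v" using less.prems by (simp add: reduced_word_iff)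
  have prd_Cons: "prd (i # is) = F i \<circ> prd is" for i "is" by (simp add: prd_def)
  \<comment> \<open>Stripping the common first letter leaves reduced words of
    \<open>sref k \<circ> w\<close>, shorter by one, for the induction hypothesis.\<close>
  have same: "prd (k # x) = prd (k # y)"
    if "reduced_word n w (k # x)" "reduced_word n w (k # y)" "length (k # x) = length u" for k x y
    using that less.hyps[of x "sref k \<circ> w" y] reduced_word_ConsD(3)[of n w k] by (simp add: prd_Cons)
  show ?case
  proof (cases u)
    case Nil
    then show ?thesis using len by simp
  next
    case (Cons i u')
    then obtain j v' where v: "v = j # v'" using len by (cases v) auto
    note u = Cons
    note di = reduced_word_ConsD[OF less.prems(1)[unfolded u]]
    note dj = reduced_word_ConsD[OF less.prems(2)[unfolded v]]
    have w: "w permutes {1..n}" using less.prems(1) by (rule reduced_word_permutes)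
    have rl: "length x = length u" if "reduced_word n w x" for x
      using that less.prems(1) by (simp add: reduced_word_iff)
    \<comment> \<open>\<open>u\<close> and \<open>i # x\<close> share their first letter, as do
      \<open>j # y\<close> and \<open>v\<close>; so only the middle equality has to come from a
      commutation or braid relation.\<close>
    have via: "prd u = prd v" if "reduced_word n w (i # x)" "reduced_word n w (j # y)"
      "prd (i # x) = prd (j # y)" for x y
      using same[OF less.prems(1)[unfolded u] that(1)] same[OF that(2) less.prems(2)[unfolded v]]
        that(3) rl[OF that(2)] u v by simp
    have assoc: "prd (a # b # c # x) = F a \<circ> F b \<circ> F c \<circ> prd x" for a b c x
      by (simp add: prd_Cons comp_assoc)
    have assoc2: "prd (a # b # x) = F a \<circ> F b \<circ> prd x" for a b x
      by (simp add: prd_Cons comp_assoc)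
    consider "i = j" | "Suc i < j" | "Suc j < i" | "j = Suc i" | "i = Suc j" by linarith
    then show ?thesis
    proof cases
      case 1
      then show ?thesis using same[of i u' v'] less.prems u v by simp
    next
      case 2
      from ex_reduced_word_commute[OF w di(1) dj(1) 2 di(2) dj(2)] obtain z
        where "reduced_word n w (i # j # z)" "reduced_word n w (j # i # z)" .
      then show ?thesis by (rule via) (simp only: assoc2 comm[OF 2])
    next
      case 3
      from ex_reduced_word_commute[OF w dj(1) di(1) 3 dj(2) di(2)] obtain z
        where z: "reduced_word n w (j # i # z)" "reduced_word n w (i # j # z)" .
      show ?thesis by (rule via[OF z(2,1)]) (simp only: assoc2 comm[OF 3])
    next
      case 4
      from ex_reduced_word_braid[OF w di(1) _ di(2)] dj 4 obtain z
        where "reduced_word n w (i # j # i # z)" "reduced_word n w (j # i # j # z)" by metis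
      then show ?thesis by (rule via) (simp only: assoc 4 braid)
    next
      case 5
      from ex_reduced_word_braid[OF w dj(1) _ dj(2)] di 5 obtain z
        where z: "reduced_word n w (j # i # j # z)" "reduced_word n w (i # j # i # z)" by metis
      show ?thesis by (rule via[OF z(2,1)]) (simp only: assoc 5 braid)
    qed
  qed
qed

section \<open>Reversal and the Poincare polynomial\<close>

lemma ninv_comp_reverse:
  assumes w: "w permutes {1..n}"
  defines "r \<equiv> \<lambda>k. if k \<in> {1..n} then Suc n - k else k"
  shows "ninv n w + ninv n (w \<circ> r) = card {(a, b). a \<in> {1..n} \<and> b \<in> {1..n} \<and> a < b}"
proof -
  have r2: "r (r k) = k" for k by (auto simp: r_def)
  have inv_r: "inv r = r" using r2 by (intro inv_unique_comp) auto
  have bij_r: "bij r" using r2 by (intro o_bij[of r]) auto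
  have e: "inv (w \<circ> r) = r \<circ> inv w" using w bij_r by (simp add: o_inv_distrib permutes_bij inv_r)
  have im: "inv w k \<in> {1..n} \<longleftrightarrow> k \<in> {1..n}" for k
    using permutes_in_image[OF permutes_inv[OF w]] by blast
  have inj: "inv w a = inv w b \<longleftrightarrow> a = b" for a b
    using permutes_inj[OF permutes_inv[OF w]] by (simp add: inj_eq)
  \<comment> \<open>Composing with the reversal \<open>r\<close> flips the order of all values of
    \<open>inv w\<close> on \<open>{1..n}\<close>, so each pair is an inversion of exactly one of
    \<open>inv w\<close> and \<open>inv (w \<circ> r)\<close>.\<close>
  have iff: "r (inv w b) < r (inv w a) \<longleftrightarrow> inv w a < inv w b" if "a \<in> {1..n}" "b \<in> {1..n}" for a b
    using im[of a] im[of b] that by (auto simp: r_def)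
  have "inversions n (inv w) \<union> inversions n (inv (w \<circ> r))
      = {(a, b). a \<in> {1..n} \<and> b \<in> {1..n} \<and> a < b}"
    unfolding e inversions_def using iff inj by (auto simp: not_less le_less)
  moreover have "inversions n (inv w) \<inter> inversions n (inv (w \<circ> r)) = {}"
    unfolding e inversions_def using iff by auto
  ultimately show ?thesis
    unfolding ninv_def by (metis card_Un_disjoint finite_inversions)
qed

text \<open>Left multiplication by \<open>sref i\<close> is an involution that exchanges ascents and
  descents of \<open>inv w\<close> at \<open>i\<close>; each coset is represented by its shorter
  element.\<close>

lemma sum_permutes_pairs:
  fixes g :: "(nat \<Rightarrow> nat) \<Rightarrow> 'a::comm_monoid_add"
  assumes i: "i \<in> {1..<n}"
  shows "(\<Sum>w | w permutes {1..n}. g w)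
    = (\<Sum>w | w permutes {1..n} \<and> inv w i < inv w (Suc i). g w + g (sref i \<circ> w))"
proof -
  let ?A = "{w. w permutes {1..n} \<and> inv w i < inv w (Suc i)}"
  let ?D = "{w. w permutes {1..n} \<and> inv w (Suc i) < inv w i}"
  have e: "inv (sref i \<circ> w) = inv w \<circ> sref i" if "w permutes {1..n}" for w
    using that by (rule inv_sref_comp)
  have fin: "finite {w. w permutes {1..n}}" by (simp add: finite_permutations)
  have "(\<Sum>w | w permutes {1..n}. g w) = (\<Sum>w\<in>?A. g w) + (\<Sum>w\<in>?D. g w)"
  proof (subst sum.union_disjoint[symmetric])
    show "finite ?A" "finite ?D" using fin by (auto elim: finite_subset[rotated])
    show "?A \<inter> ?D = {}" by auto
    have "{w. w permutes {1..n}} = ?A \<union> ?D" using ascent_or_descent by blast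
    then show "(\<Sum>w | w permutes {1..n}. g w) = sum g (?A \<union> ?D)" by (rule arg_cong)
  qed
  also have "(\<Sum>w\<in>?D. g w) = (\<Sum>w\<in>?A. g (sref i \<circ> w))"
    by (rule sum.reindex_bij_witness[of _ "\<lambda>w. sref i \<circ> w" "\<lambda>w. sref i \<circ> w"])
      (auto simp: sref_sref_comp e sref_comp_permutes[OF i] simp del: o_apply, auto)
  finally show ?thesis by (simp add: sum.distrib)
qed

text \<open>The two lengths in each pair differ by one, so their terms cancel. This is how t = -1 is
  excluded for \<open>n \<ge> 2\<close>.\<close>

lemma poincare_neg_one:
  assumes "n \<ge> 2"
  shows "poincare n (- 1) = 0"
proof -
  have i: "1 \<in> {1..<n}" using assms by auto
  have "(- 1 :: complex) ^ perm_length n w + (- 1) ^ perm_length n (sref 1 \<circ> w) = 0"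
    if "w permutes {1..n}" "inv w 1 < inv w (Suc 1)" for w
    using perm_length_ascent[OF that(1) i that(2)] by simp
  then show ?thesis
    unfolding poincare_def sum_permutes_pairs[OF i] by (intro sum.neutral) blast
qed

text \<open>Reversal gives \<open>poincare n t = t ^ N * poincare n (inverse t)\<close>. The
  fermionic symmetrizer needs the value at \<open>inverse t\<close>, as its eigenvalue
  \<open>- inverse th\<close> has square 1/t.\<close>

lemma poincare_inverse_nonzero:
  assumes "poincare n t \<noteq> 0" "t \<noteq> 0"
  shows "poincare n (inverse t) \<noteq> 0"
proof -
  define r where "r = (\<lambda>k. if k \<in> {1..n} then Suc n - k else k)"
  define N where "N = card {(a, b). a \<in> {1..n} \<and> b \<in> {1..n} \<and> a < b}"
  have r2: "r (r k) = k" for k by (auto simp: r_def)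
  have r: "r permutes {1..n}"
    by (intro bij_imp_permutes bij_betw_byWitness[of _ r]) (auto simp: r_def)
  have "poincare n t = (\<Sum>w | w permutes {1..n}. t ^ perm_length n (w \<circ> r))"
    unfolding poincare_def
    by (rule sum.reindex_bij_witness[of _ "\<lambda>w. w \<circ> r" "\<lambda>w. w \<circ> r"])
      (use r permutes_compose[OF r] r2 in \<open>auto simp: comp_def\<close>)
  also have "\<dots> = (\<Sum>w | w permutes {1..n}. t ^ N * inverse t ^ perm_length n w)"
  proof (rule sum.cong)
    fix w assume "w \<in> {w. w permutes {1..n}}"
    then have w: "w permutes {1..n}" by simp
    have "perm_length n w + perm_length n (w \<circ> r) = N"
      using ninv_comp_reverse[OF w] permutes_compose[OF r w] w
      by (simp add: perm_length_eq_ninv N_def r_def)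
    then have "t ^ N = t ^ perm_length n w * t ^ perm_length n (w \<circ> r)" by (simp flip: power_add)
    then show "t ^ perm_length n (w \<circ> r) = t ^ N * inverse t ^ perm_length n w"
      using assms(2) by (simp add: power_inverse)
  qed simp
  also have "\<dots> = t ^ N * poincare n (inverse t)" by (simp add: poincare_def sum_distrib_left)
  finally show ?thesis using assms by auto
qed

section \<open>Homomorphisms of Laurent polynomials\<close>

lemma const_0 [simp]: "const 0 = 0" and const_1 [simp]: "const 1 = 1"
  by (simp_all add: const_def)

lemma const_add: "const (c + d) = const c + const d"
  by (simp add: const_def single_add)

lemma const_mult: "const (c * d) = const c * const d"
  by (simp add: const_def mult_single)

lemma const_minus: "const (- c) = - const c"
  by (simp add: const_def single_uminus)

lemma const_diff: "const (c - d) = const c - const d"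
  using const_add[of c "- d"] by (simp add: const_minus)

lemma const_sum: "const (sum g A) = (\<Sum>x\<in>A. const (g x))"
  by (induction A rule: infinite_finite_induct) (simp_all add: const_add)

lemma const_eq_0_iff [simp]: "const c = 0 \<longleftrightarrow> c = 0"
  by (metis const_def lookup_single_eq lookup_zero single_zero)

lemma X_neq_0 [simp]: "X i \<noteq> 0"
  using X_Xinv[of i] by auto

lemma single_1_int_power:
  "Poly_Mapping.single (Poly_Mapping.single i (int k)) 1 = X i ^ k"
  "Poly_Mapping.single (Poly_Mapping.single i (- int k)) 1 = Xinv i ^ k"
proof (induction k)
  case (Suc k)
  have "Poly_Mapping.single i (int (Suc k)) = Poly_Mapping.single i 1 + Poly_Mapping.single i (int k)"
    "Poly_Mapping.single i (- int (Suc k)) = Poly_Mapping.single i (- 1) + Poly_Mapping.single i (- int k)"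
    by (simp_all flip: single_add)
  then have
    "Poly_Mapping.single (Poly_Mapping.single i (int (Suc k))) (1 :: complex)
      = X i * Poly_Mapping.single (Poly_Mapping.single i (int k)) 1"
    "Poly_Mapping.single (Poly_Mapping.single i (- int (Suc k))) (1 :: complex)
      = Xinv i * Poly_Mapping.single (Poly_Mapping.single i (- int k)) 1"
    by (simp_all only: X_def Xinv_def mult_single mult_1)
  then show
    "Poly_Mapping.single (Poly_Mapping.single i (int (Suc k))) 1 = X i ^ Suc k"
    "Poly_Mapping.single (Poly_Mapping.single i (- int (Suc k))) 1 = Xinv i ^ Suc k"
    by (simp_all only: Suc power_Suc)
qed simp_all

text \<open>Every monomial is a product of powers of \<open>X i\<close> and \<open>Xinv i\<close>,
  so a property closed under sums and products can be checked on generators.\<close>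

lemma lpoly_ring_induct [case_names const X Xinv add mult]:
  assumes "\<And>c. P (const c)" "\<And>i. P (X i)" "\<And>i. P (Xinv i)"
    "\<And>f g. P f \<Longrightarrow> P g \<Longrightarrow> P (f + g)" "\<And>f g. P f \<Longrightarrow> P g \<Longrightarrow> P (f * g)"
  shows "P f"
proof -
  have pow: "P (g ^ k)" if "P g" for g k
    using that assms(1)[of 1] by (induction k) (auto intro: assms(5))
  have mono: "P (Poly_Mapping.single m 1)" for m
  proof (induction m rule: Poly_Mapping.update_induct)
    case const
    show ?case using assms(1)[of 1] by (simp add: const_def)
  next
    case (update m a b)
    have "Poly_Mapping.update a b m = m + Poly_Mapping.single a b"
      using update(1)
      by (intro poly_mapping_eqI) (auto simp: lookup_update lookup_add lookup_single in_keys_iff)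
    then have "Poly_Mapping.single (Poly_Mapping.update a b m) (1 :: complex)
        = Poly_Mapping.single m 1 * Poly_Mapping.single (Poly_Mapping.single a b) 1"
      by (simp add: mult_single)
    moreover have "P (Poly_Mapping.single (Poly_Mapping.single a b) 1)"
    proof (cases b rule: int_cases2)
      case (nonneg k)
      then show ?thesis using pow[OF assms(2)] single_1_int_power(1)[of a k] by metis
    next
      case (nonpos k)
      then show ?thesis using pow[OF assms(3)] single_1_int_power(2)[of a k] by metis
    qed
    ultimately show ?case using assms(5) update by metis
  qed
  show ?thesis
  proof (induction f rule: lpoly_induct)
    case (single m c)
    have "Poly_Mapping.single m c = const c * Poly_Mapping.single m 1"
      by (simp add: const_def mult_single)
    then show ?case using assms(1,5) mono by metis
  qed (rule assms(4))
qed

section \<open>Algebra endomorphisms and the permutation action\<close>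

locale lpoly_hom =
  fixes h :: "lpoly \<Rightarrow> lpoly"
  assumes hom_add: "h (f + g) = h f + h g"
    and hom_mult: "h (f * g) = h f * h g"
    and hom_const: "h (const c) = const c"
begin

lemma hom_0 [simp]: "h 0 = 0" and hom_1 [simp]: "h 1 = 1"
  using hom_const[of 0] hom_const[of 1] by simp_all

lemma hom_minus: "h (- f) = - h f"
  using hom_add[of f "- f"] by (simp add: eq_neg_iff_add_eq_0 add.commute)

lemma hom_diff: "h (f - g) = h f - h g"
  using hom_add[of f "- g"] by (simp add: hom_minus)

lemma hom_prod: "h (prod g A) = (\<Prod>x\<in>A. h (g x))"
  by (induction A rule: infinite_finite_induct) (simp_all add: hom_mult)

lemma hom_X_Xinv: "h (X i) * h (Xinv i) = 1"
  by (simp add: X_Xinv flip: hom_mult)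

end

lemma lpoly_hom_comp: "lpoly_hom h \<Longrightarrow> lpoly_hom k \<Longrightarrow> lpoly_hom (\<lambda>f. h (k f))"
  by (simp add: lpoly_hom_def)

lemma lpoly_hom_id: "lpoly_hom (\<lambda>f. f)"
  by (simp add: lpoly_hom_def)

lemma lpoly_hom_act: "bij \<sigma> \<Longrightarrow> lpoly_hom (act \<sigma>)"
  by (simp add: lpoly_hom_def act_add act_mult act_const)

lemma lpoly_hom_eqI:
  assumes h: "lpoly_hom h" and k: "lpoly_hom k" and eq: "\<And>i. h (X i) = k (X i)"
  shows "h f = k f"
proof (induction f rule: lpoly_ring_induct)
  case (Xinv i)
  \<comment> \<open>The image of \<open>X i\<close> is a unit, so it determines the image of
    \<open>Xinv i\<close>.\<close>
  have "h (X i) * h (Xinv i) = h (X i) * k (Xinv i)" "h (X i) \<noteq> 0"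
    using lpoly_hom.hom_X_Xinv[OF h, of i] lpoly_hom.hom_X_Xinv[OF k, of i] eq by auto
  then show ?case by simp
qed (simp_all add: eq lpoly_hom.hom_const[OF h] lpoly_hom.hom_const[OF k]
    lpoly_hom.hom_add[OF h] lpoly_hom.hom_add[OF k] lpoly_hom.hom_mult[OF h] lpoly_hom.hom_mult[OF k])

lemma act_act:
  assumes "bij \<sigma>" "bij \<tau>"
  shows "act \<sigma> (act \<tau> f) = act (\<sigma> \<circ> \<tau>) f"
proof (rule lpoly_hom_eqI[of "\<lambda>f. act \<sigma> (act \<tau> f)"])
  show "lpoly_hom (\<lambda>f. act \<sigma> (act \<tau> f))" "lpoly_hom (act (\<sigma> \<circ> \<tau>))"
    by (rule lpoly_hom_comp[OF assms[THEN lpoly_hom_act]])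
      (rule lpoly_hom_act[OF bij_comp[OF assms(2,1)]])
  show "act \<sigma> (act \<tau> (X i)) = act (\<sigma> \<circ> \<tau>) (X i)" for i
    unfolding act_X[OF assms(2)] act_X[OF assms(1)] act_X[OF bij_comp[OF assms(2,1)]] by simp
qed

lemma act_id: "act id f = f"
  by (rule lpoly_hom_eqI[of "act id"]) (auto intro: lpoly_hom_act lpoly_hom_id simp: act_X)

lemma act_sref_sref [simp]: "act (sref i) (act (sref i) f) = f"
  by (simp add: act_act act_id)

section \<open>Monomial substitutions and their kernels\<close>

definition monomial_map ::
    "((nat \<Rightarrow>\<^sub>0 int) \<Rightarrow> (nat \<Rightarrow>\<^sub>0 int)) \<Rightarrow> ((nat \<Rightarrow>\<^sub>0 int) \<Rightarrow> complex) \<Rightarrow> lpoly \<Rightarrow> lpoly" where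
  "monomial_map \<mu> \<chi> f =
    (\<Sum>m\<in>Poly_Mapping.keys f. Poly_Mapping.single (\<mu> m) (\<chi> m * Poly_Mapping.lookup f m))"

lemma monomial_map_superset:
  assumes "finite S" "Poly_Mapping.keys f \<subseteq> S"
  shows "monomial_map \<mu> \<chi> f
    = (\<Sum>m\<in>S. Poly_Mapping.single (\<mu> m) (\<chi> m * Poly_Mapping.lookup f m))"
  unfolding monomial_map_def
  by (rule sum.mono_neutral_left) (use assms in \<open>auto simp: in_keys_iff\<close>)

lemma monomial_map_single:
  "monomial_map \<mu> \<chi> (Poly_Mapping.single m c) = Poly_Mapping.single (\<mu> m) (\<chi> m * c)"
  by (subst monomial_map_superset[of "{m}"]) simp_all

lemma monomial_map_add: "monomial_map \<mu> \<chi> (f + g) = monomial_map \<mu> \<chi> f + monomial_map \<mu> \<chi> g"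
proof -
  let ?S = "Poly_Mapping.keys f \<union> Poly_Mapping.keys g"
  have "Poly_Mapping.keys (f + g) \<subseteq> ?S" by (rule keys_add)
  then show ?thesis
    by (simp add: monomial_map_superset[of ?S] lookup_add distrib_left single_add sum.distrib)
qed

text \<open>Both substitutions below, \<open>identify\<close> and \<open>restrict_vars\<close>,
  arise this way; by bilinearity the product rule is checked on monomials only.\<close>

lemma lpoly_hom_monomial_map:
  assumes "\<And>m m'. \<mu> (m + m') = \<mu> m + \<mu> m'" "\<And>m m'. \<chi> (m + m') = \<chi> m * \<chi> m'" "\<chi> 0 = 1"
  shows "lpoly_hom (monomial_map \<mu> \<chi>)"
proof
  show "monomial_map \<mu> \<chi> (f * g) = monomial_map \<mu> \<chi> f * monomial_map \<mu> \<chi> g" for f g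
  proof (induction f rule: lpoly_induct)
    case (single m c)
    show ?case
    proof (induction g rule: lpoly_induct)
      case (single m' c')
      then show ?case by (simp add: mult_single monomial_map_single assms mult_ac)
    qed (simp add: distrib_left monomial_map_add)
  qed (simp add: distrib_right monomial_map_add)
  have "\<mu> 0 = 0" using assms(1)[of 0 0] by simp
  then show "monomial_map \<mu> \<chi> (const c) = const c" for c
    by (simp add: const_def monomial_map_single assms)
qed (rule monomial_map_add)

text \<open>The substitution \<open>X j \<mapsto> c X i\<close>.\<close>

definition identify :: "complex \<Rightarrow> nat \<Rightarrow> nat \<Rightarrow> lpoly \<Rightarrow> lpoly" where
  "identify c i j = monomial_map
    (\<lambda>m. m + Poly_Mapping.single i (Poly_Mapping.lookup m j) - Poly_Mapping.single j (Poly_Mapping.lookup m j))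
    (\<lambda>m. c powi Poly_Mapping.lookup m j)"

lemma lpoly_hom_identify: "c \<noteq> 0 \<Longrightarrow> lpoly_hom (identify c i j)"
  unfolding identify_def
  by (rule lpoly_hom_monomial_map) (simp_all add: lookup_add single_add power_int_add)

lemma identify_X: "identify c i j (X k) = (if k = j then const c * X i else X k)"
  by (auto simp: identify_def monomial_map_single X_def const_def mult_single lookup_single)

text \<open>Modulo \<open>X j - const c * X i\<close> the substitution fixes every generator, hence
  everything.\<close>

lemma dvd_diff_identify:
  assumes "c \<noteq> 0"
  shows "X j - const c * X i dvd f - identify c i j f"
proof -
  interpret lpoly_hom "identify c i j" using assms by (rule lpoly_hom_identify)
  let ?p = "X j - const c * X i"
  show ?thesis
  proof (induction f rule: lpoly_ring_induct)
    case (const c)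
    show ?case by (simp add: hom_const)
  next
    case (X k)
    show ?case by (simp add: identify_X)
  next
    case (Xinv k)
    \<comment> \<open>The identity 1/x - 1/y = -(x - y)/(x y) reduces the inverse variable to the
      variable.\<close>
    have "Xinv k - identify c i j (Xinv k) =
        X k * identify c i j (X k) * (Xinv k * identify c i j (Xinv k)) * (Xinv k - identify c i j (Xinv k))"
      using X_Xinv[of k] hom_X_Xinv[of k] by (simp add: mult_ac)
    also have "\<dots> = (X k * Xinv k * identify c i j (X k) - X k * (identify c i j (X k) * identify c i j (Xinv k)))
        * (Xinv k * identify c i j (Xinv k))"
      by (simp add: algebra_simps)
    also have "\<dots> = - (X k - identify c i j (X k)) * (Xinv k * identify c i j (Xinv k))"
      by (simp add: X_Xinv hom_X_Xinv)
    finally have *: "Xinv k - identify c i j (Xinv k)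
        = - (X k - identify c i j (X k)) * (Xinv k * identify c i j (Xinv k))" .
    have "?p dvd X k - identify c i j (X k)" by (simp add: identify_X)
    then show ?case unfolding * by (intro dvd_mult2) (simp only: dvd_minus_iff)
  next
    case (add f g)
    have "f + g - identify c i j (f + g) = (f - identify c i j f) + (g - identify c i j g)"
      by (simp add: hom_add)
    then show ?case using add by (metis dvd_add)
  next
    case (mult f g)
    have "f * g - identify c i j (f * g)
        = (f - identify c i j f) * g + identify c i j f * (g - identify c i j g)"
      by (simp add: hom_mult algebra_simps)
    then show ?case using mult by (metis dvd_add dvd_mult dvd_mult2)
  qed
qed

text \<open>This is the form in which primality of the factors is used: divisibility of a product is
  tested by a homomorphism into an integral domain.\<close>

lemma dvd_iff_identify:
  assumes "c \<noteq> 0" "i \<noteq> j"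
  shows "X j - const c * X i dvd f \<longleftrightarrow> identify c i j f = 0"
proof
  interpret lpoly_hom "identify c i j" using assms(1) by (rule lpoly_hom_identify)
  assume "X j - const c * X i dvd f"
  then show "identify c i j f = 0"
    using assms(2) by (auto simp: dvd_def hom_mult hom_diff hom_const identify_X)
next
  assume "identify c i j f = 0"
  then show "X j - const c * X i dvd f" using dvd_diff_identify[OF assms(1), of j i f] by simp
qed

lemma const_X_eq_iff:
  assumes "k \<noteq> l" "c \<noteq> 0"
  shows "const c * X k \<noteq> const d * X l"
proof
  assume "const c * X k = const d * X l"
  then have "Poly_Mapping.lookup (const c * X k) (Poly_Mapping.single k 1)
      = Poly_Mapping.lookup (const d * X l) (Poly_Mapping.single k 1)" by simp
  moreover have "Poly_Mapping.single l (1 :: int) \<noteq> Poly_Mapping.single k 1"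
    using assms(1) by (metis keys_single singleton_inject zero_neq_one)
  ultimately show False
    using assms by (simp add: const_def X_def mult_single lookup_single)
qed

text \<open>The substitution \<open>X k \<mapsto> 1\<close> for \<open>k\<close> outside \<open>{1..n}\<close>.\<close>

definition restrict_vars :: "nat \<Rightarrow> lpoly \<Rightarrow> lpoly" where
  "restrict_vars n = monomial_map
    (\<lambda>m. \<Sum>k\<in>{1..n}. Poly_Mapping.single k (Poly_Mapping.lookup m k)) (\<lambda>m. 1)"

lemma lpoly_hom_restrict_vars: "lpoly_hom (restrict_vars n)"
  unfolding restrict_vars_def
  by (rule lpoly_hom_monomial_map) (simp_all add: lookup_add single_add sum.distrib)

lemma lookup_sum_single:
  "Poly_Mapping.lookup (\<Sum>k\<in>{1..n}. Poly_Mapping.single k (Poly_Mapping.lookup m k)) l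
    = (if l \<in> {1..n} then Poly_Mapping.lookup m l else 0)"
  for m :: "nat \<Rightarrow>\<^sub>0 int"
  by (auto simp: lookup_sum lookup_single when_def if_distrib cong: if_cong)

lemma restrict_vars_X: "restrict_vars n (X k) = (if k \<in> {1..n} then X k else 1)"
proof -
  have "(\<Sum>l\<in>{1..n}. Poly_Mapping.single l (Poly_Mapping.lookup (Poly_Mapping.single k (1 :: int)) l))
      = (if k \<in> {1..n} then Poly_Mapping.single k 1 else 0)"
    by (rule poly_mapping_eqI, subst lookup_sum_single) (auto simp: lookup_single when_def)
  then show ?thesis by (simp add: restrict_vars_def monomial_map_single X_def)
qed

text \<open>Describing \<open>laurent n\<close> as the fixed set of a ring homomorphism reduces its
  closure properties, including cancellation, to homomorphism laws.\<close>

lemma laurent_iff_restrict_vars: "f \<in> laurent n \<longleftrightarrow> restrict_vars n f = f"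
proof
  let ?\<mu> = "\<lambda>m. \<Sum>k\<in>{1..n}. Poly_Mapping.single k (Poly_Mapping.lookup m k) :: nat \<Rightarrow>\<^sub>0 int"
  assume f: "f \<in> laurent n"
  have "?\<mu> m = m" if "m \<in> Poly_Mapping.keys f" for m
  proof (rule poly_mapping_eqI)
    fix l
    have "l \<in> {1..n}" if "Poly_Mapping.lookup m l \<noteq> 0"
      using f \<open>m \<in> Poly_Mapping.keys f\<close> that in_keys_iff[of l m] unfolding laurent_def by blast
    then show "Poly_Mapping.lookup (?\<mu> m) l = Poly_Mapping.lookup m l"
      unfolding lookup_sum_single by auto
  qed
  then have "restrict_vars n f
      = (\<Sum>m\<in>Poly_Mapping.keys f. Poly_Mapping.single m (Poly_Mapping.lookup f m))"
    unfolding restrict_vars_def monomial_map_def by (intro sum.cong) auto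
  also have "\<dots> = f"
    by (rule poly_mapping_eqI) (auto simp: lookup_sum lookup_single when_def in_keys_iff)
  finally show "restrict_vars n f = f" .
next
  let ?\<mu> = "\<lambda>m. \<Sum>k\<in>{1..n}. Poly_Mapping.single k (Poly_Mapping.lookup m k) :: nat \<Rightarrow>\<^sub>0 int"
  assume eq: "restrict_vars n f = f"
  have "Poly_Mapping.keys m \<subseteq> {1..n}" if m: "m \<in> Poly_Mapping.keys f" for m
  proof -
    have "m \<in> Poly_Mapping.keys (restrict_vars n f)" using m eq by simp
    then obtain m' where "m = ?\<mu> m'"
      unfolding restrict_vars_def monomial_map_def
      using keys_sum[of "\<lambda>m. Poly_Mapping.single (?\<mu> m) (1 * Poly_Mapping.lookup f m)" "Poly_Mapping.keys f"]
      by (auto split: if_splits)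
    then show ?thesis using lookup_sum_single[where n = n and m = m'] by (auto simp: in_keys_iff split: if_splits)
  qed
  then show "f \<in> laurent n" by (auto simp: laurent_def)
qed

section \<open>Closure properties of \<open>laurent n\<close>\<close>

lemma laurent_const [simp]: "const c \<in> laurent n"
  by (simp add: laurent_iff_restrict_vars lpoly_hom.hom_const[OF lpoly_hom_restrict_vars])

lemma laurent_0 [simp]: "0 \<in> laurent n"
  using laurent_const[of 0 n] by simp

lemma laurent_X: "k \<in> {1..n} \<Longrightarrow> X k \<in> laurent n"
  by (simp add: laurent_iff_restrict_vars restrict_vars_X)

lemma laurent_add: "f \<in> laurent n \<Longrightarrow> g \<in> laurent n \<Longrightarrow> f + g \<in> laurent n"
  by (simp add: laurent_iff_restrict_vars lpoly_hom.hom_add[OF lpoly_hom_restrict_vars])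

lemma laurent_minus: "f \<in> laurent n \<Longrightarrow> - f \<in> laurent n"
  by (simp add: laurent_iff_restrict_vars lpoly_hom.hom_minus[OF lpoly_hom_restrict_vars])

lemma laurent_diff: "f \<in> laurent n \<Longrightarrow> g \<in> laurent n \<Longrightarrow> f - g \<in> laurent n"
  by (simp add: laurent_iff_restrict_vars lpoly_hom.hom_diff[OF lpoly_hom_restrict_vars])

lemma laurent_mult: "f \<in> laurent n \<Longrightarrow> g \<in> laurent n \<Longrightarrow> f * g \<in> laurent n"
  by (simp add: laurent_iff_restrict_vars lpoly_hom.hom_mult[OF lpoly_hom_restrict_vars])

lemma laurent_sum: "(\<And>x. x \<in> A \<Longrightarrow> g x \<in> laurent n) \<Longrightarrow> sum g A \<in> laurent n"
  by (induction A rule: infinite_finite_induct) (auto intro: laurent_add)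

lemma laurent_prod: "(\<And>x. x \<in> A \<Longrightarrow> g x \<in> laurent n) \<Longrightarrow> prod g A \<in> laurent n"
  using laurent_const[of 1 n] by (induction A rule: infinite_finite_induct) (auto intro: laurent_mult)

text \<open>\<open>restrict_vars n\<close> fixes \<open>p\<close> and \<open>p * f\<close>, so it
  fixes \<open>f\<close> after cancelling \<open>p\<close>.\<close>

lemma laurent_cancel:
  assumes "p \<in> laurent n" "p \<noteq> 0" "p * f \<in> laurent n"
  shows "f \<in> laurent n"
  using assms by (simp add: laurent_iff_restrict_vars lpoly_hom.hom_mult[OF lpoly_hom_restrict_vars])

lemma laurent_act:
  assumes i: "i \<in> {1..<n}" and f: "f \<in> laurent n"
  shows "act (sref i) f \<in> laurent n"
proof -
  have "restrict_vars n (act (sref i) f) = act (sref i) (restrict_vars n f)"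
  proof (rule lpoly_hom_eqI[of "\<lambda>f. restrict_vars n (act (sref i) f)"])
    have "sref i k \<in> {1..n} \<longleftrightarrow> k \<in> {1..n}" for k
      using permutes_in_image[OF sref_permutes[OF i]] .
    then show "restrict_vars n (act (sref i) (X k)) = act (sref i) (restrict_vars n (X k))" for k
      unfolding act_X[OF bij_sref] restrict_vars_X by (simp add: act_X act_one)
  qed (rule lpoly_hom_comp[OF lpoly_hom_restrict_vars lpoly_hom_act[OF bij_sref]],
      rule lpoly_hom_comp[OF lpoly_hom_act[OF bij_sref] lpoly_hom_restrict_vars])
  then show ?thesis using f by (simp add: laurent_iff_restrict_vars)
qed

section \<open>Relations of the operators\<close>

lemma X_eq_iff [simp]: "X i = X j \<longleftrightarrow> i = j"
  using const_X_eq_iff[of i j 1 1] by auto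

text \<open>Since \<open>X i * (1 - Xinv i * X (Suc i)) = X i - X (Suc i)\<close>, multiplication by
  this difference leaves the fraction field; identities between operators become polynomial
  identities in the ring.\<close>

lemma hecke_T_eq:
  "(X i - X (Suc i)) * hecke_T th i f
    = (const (inverse th) - const th) * X (Suc i) * f
      + (const th * X i - const (inverse th) * X (Suc i)) * act (sref i) f"
proof -
  define a where "a = const (inverse th)"
  define b where "b = const th"
  define x where "x = X i"
  define y where "y = X (Suc i)"
  define Y where "Y = Xinv i * X (Suc i)"
  define Y' where "Y' = Xinv (Suc i) * X i"
  define g where "g = act (sref i) f"
  have xY: "x * Y = y" and yY': "y * Y' = x"
    using X_Xinv by (simp_all add: x_def y_def Y_def Y'_def flip: mult.assoc)
  have Y1: "1 - Y \<noteq> 0" using Y_neq_1 by (simp add: Y_def)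
  have xy: "x - y \<noteq> 0" "x \<noteq> 0" "y \<noteq> 0" by (simp_all add: x_def y_def)
  have Y'1: "1 - Y' \<noteq> 0" using yY' xy by auto
  have "act (sref i) (a - b * Y) = a - b * Y'" "act (sref i) (1 - Y) = 1 - Y'"
    by (simp_all add: act_diff act_mult act_const act_one act_X act_Xinv a_def b_def Y_def Y'_def)
  then have s: "s_fract i (Fract ((a - b * Y) * f) (1 - Y)) = Fract ((a - b * Y') * g) (1 - Y')"
    using Y1 by (simp add: s_fract_Fract act_mult g_def)
  have 1: "Fract ((a - b * Y) * f) (1 - Y) = Fract ((a * x - b * y) * f) (x - y)"
    using Y1 xy by (simp add: eq_fract) (simp add: algebra_simps flip: xY)
  \<comment> \<open>The transposition inverts \<open>Y\<close>, so the second fraction is brought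
    over \<open>x - y\<close> by multiplying numerator and denominator by
    \<open>- y\<close>.\<close>
  have 2: "Fract ((a - b * Y') * g) (1 - Y') = Fract ((b * x - a * y) * g) (x - y)"
    using Y'1 xy by (simp add: eq_fract) (simp add: algebra_simps flip: yY')
  have "to_fract (hecke_T th i f) = - to_fract (a * f) + (Fract ((a * x - b * y) * f) (x - y)
      + Fract ((b * x - a * y) * g) (x - y))"
  proof -
    have A: "to_fract (a - b * Y) / to_fract (1 - Y) * to_fract f = Fract ((a - b * Y) * f) (1 - Y)"
      using Y1 by (simp add: to_fract_def divide_fract)
    have B: "const (inverse th) - const th * Xinv i * X (Suc i) = a - b * Y"
      by (simp add: a_def b_def Y_def mult.assoc)
    show ?thesis
      unfolding hecke_T_fract T_fract_def Let_def B
      unfolding a_def[symmetric] Y_def[symmetric] A 1 s[unfolded 1 2] by simp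
  qed
  also have "\<dots> = - to_fract (a * f) + (to_fract ((a * x - b * y) * f) / to_fract (x - y)
      + to_fract ((b * x - a * y) * g) / to_fract (x - y))"
    using xy(1) by (simp add: to_fract_def divide_fract)
  finally have "to_fract (x - y) * to_fract (hecke_T th i f)
      = - to_fract (x - y) * to_fract (a * f)
        + (to_fract ((a * x - b * y) * f) + to_fract ((b * x - a * y) * g))"
    using xy(1) by (simp add: distrib_left right_diff_distrib del: to_fract_diff)
  also have "\<dots> = to_fract (- (x - y) * (a * f) + ((a * x - b * y) * f + (b * x - a * y) * g))"
    by simp
  finally have "(x - y) * hecke_T th i f
      = - (x - y) * (a * f) + ((a * x - b * y) * f + (b * x - a * y) * g)"
    by (metis to_fract_mult to_fract_eq_iff)
  also have "\<dots> = (a - b) * y * f + (b * x - a * y) * g"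
    by (simp add: algebra_simps)
  finally show ?thesis by (simp add: a_def b_def x_def y_def g_def)
qed

lemma hecke_T_eqI:
  assumes "(X i - X (Suc i)) * h
    = (const (inverse th) - const th) * X (Suc i) * f
      + (const th * X i - const (inverse th) * X (Suc i)) * act (sref i) f"
  shows "hecke_T th i f = h"
  using assms hecke_T_eq[of i th f] X_eq_iff[of i "Suc i"] by (metis mult_left_cancel n_not_Suc_n right_minus_eq)

lemma hecke_T_add: "hecke_T th i (f + g) = hecke_T th i f + hecke_T th i g"
  by (rule hecke_T_eqI) (simp add: distrib_left hecke_T_eq act_add)

lemma hecke_T_const_mult: "hecke_T th i (const c * f) = const c * hecke_T th i f"
  by (rule hecke_T_eqI) (simp add: mult.left_commute[of _ "const c"] hecke_T_eq act_mult act_const distrib_left)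

lemma hecke_T_0: "hecke_T th i 0 = 0"
  using hecke_T_const_mult[of th i 0 0] by simp

lemma hecke_T_sum: "hecke_T th i (sum g A) = (\<Sum>x\<in>A. hecke_T th i (g x))"
  by (induction A rule: infinite_finite_induct) (simp_all add: hecke_T_0 hecke_T_add)

lemma laurent_hecke_T:
  assumes "i \<in> {1..<n}" "f \<in> laurent n"
  shows "hecke_T th i f \<in> laurent n"
proof (rule laurent_cancel)
  have X: "X i \<in> laurent n" "X (Suc i) \<in> laurent n" using assms(1) by (auto intro: laurent_X)
  then show "X i - X (Suc i) \<in> laurent n" by (rule laurent_diff)
  show "X i - X (Suc i) \<noteq> 0" by simp
  show "(X i - X (Suc i)) * hecke_T th i f \<in> laurent n"
    unfolding hecke_T_eq using X assms laurent_act[OF assms]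
    by (intro laurent_add laurent_mult laurent_diff laurent_const)
qed

lemma act_hecke_T_eq:
  "bij \<sigma> \<Longrightarrow> (X (\<sigma> i) - X (\<sigma> (Suc i))) * act \<sigma> (hecke_T th i f)
    = (const (inverse th) - const th) * X (\<sigma> (Suc i)) * act \<sigma> f
      + (const th * X (\<sigma> i) - const (inverse th) * X (\<sigma> (Suc i))) * act \<sigma> (act (sref i) f)"
  using arg_cong[OF hecke_T_eq[of i th f], of "act \<sigma>"]
  by (simp add: act_mult act_add act_diff act_const act_X)

section \<open>Quadratic, commutation and braid relations\<close>

lemma const_inverse_mult: "th \<noteq> 0 \<Longrightarrow> const (inverse th) * const th = 1"
  by (simp flip: const_mult)

lemma hecke_T_quadratic:
  assumes "th \<noteq> 0"
  shows "hecke_T th i (hecke_T th i f) = (const th - const (inverse th)) * hecke_T th i f + f"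
proof (rule hecke_T_eqI)
  define a b where "a = const (inverse th)" and "b = const th"
  define x y where "x = X i" and "y = X (Suc i)"
  define g h h' where "g = act (sref i) f" and "h = hecke_T th i f" and "h' = act (sref i) h"
  have ab: "a * b = 1" using const_inverse_mult[OF assms] by (simp add: a_def b_def)
  have xy: "x - y \<noteq> 0" by (simp add: x_def y_def)
  have 1: "(x - y) * h = (a - b) * y * f + (b * x - a * y) * g"
    unfolding a_def b_def x_def y_def g_def h_def by (rule hecke_T_eq)
  have 2: "(y - x) * h' = (a - b) * x * g + (b * y - a * x) * f"
    using act_hecke_T_eq[of "sref i" i th f]
    by (simp add: a_def b_def x_def y_def g_def h_def h'_def)
  \<comment> \<open>Both \<open>h\<close> and \<open>h'\<close> carry the denominator
    \<open>x - y\<close> up to sign; the second factor \<open>x - y\<close> makes the equations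
    \<open>1\<close> and \<open>2\<close> applicable.\<close>
  have "(x - y) * ((x - y) * ((b - a) * h + f)) = (x - y) * ((a - b) * y * h + (b * x - a * y) * h')"
    using 1 2 ab by algebra
  then have "(x - y) * ((b - a) * h + f) = (a - b) * y * h + (b * x - a * y) * h'"
    using mult_left_cancel[OF xy] by blast
  then show "(X i - X (Suc i)) * ((const th - const (inverse th)) * hecke_T th i f + f)
      = (const (inverse th) - const th) * X (Suc i) * hecke_T th i f
        + (const th * X i - const (inverse th) * X (Suc i)) * act (sref i) (hecke_T th i f)"
    by (simp add: a_def b_def x_def y_def g_def h_def h'_def)
qed

lemma hecke_T_commute:
  assumes "Suc i < j"
  shows "hecke_T th i (hecke_T th j f) = hecke_T th j (hecke_T th i f)"
proof (rule hecke_T_eqI)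
  define a b where "a = const (inverse th)" and "b = const th"
  define x y u v where "x = X i" and "y = X (Suc i)" and "u = X j" and "v = X (Suc j)"
  define fi fj where "fi = act (sref i) f" and "fj = act (sref j) f"
  define fij where "fij = act (sref i) fj"
  define g h where "g = hecke_T th i f" and "h = hecke_T th j f"
  define gj hi where "gj = act (sref j) g" and "hi = act (sref i) h"
  define k where "k = hecke_T th j g"
  have neq: "u - v \<noteq> 0" by (simp add: u_def v_def)
  have s: "sref i j = j" "sref i (Suc j) = Suc j" "sref j i = i" "sref j (Suc i) = Suc i"
    using assms by (auto simp: transpose_def)
  have "sref j \<circ> sref i = sref i \<circ> sref j" using assms by (auto simp: fun_eq_iff transpose_def)
  then have c: "act (sref j) fi = fij" by (simp add: fij_def fi_def fj_def act_act)
  note defs = a_def b_def x_def y_def u_def v_def fi_def fj_def g_def h_def gj_def hi_def k_def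
  have 1: "(x - y) * g = (a - b) * y * f + (b * x - a * y) * fi"
    and 2: "(u - v) * h = (a - b) * v * f + (b * u - a * v) * fj"
    and 3: "(u - v) * k = (a - b) * v * g + (b * u - a * v) * gj"
    unfolding defs by (rule hecke_T_eq)+
  have 4: "(x - y) * gj = (a - b) * y * fj + (b * x - a * y) * fij"
    using act_hecke_T_eq[of "sref j" i th f] c s by (simp add: defs)
  have 5: "(u - v) * hi = (a - b) * v * fi + (b * u - a * v) * fij"
    using act_hecke_T_eq[of "sref i" j th f] s by (simp add: defs fij_def)
  \<comment> \<open>The factor \<open>u - v\<close> lets \<open>2\<close>, \<open>3\<close> and
    \<open>5\<close> replace \<open>h\<close>, \<open>k\<close> and \<open>hi\<close>; then
    \<open>1\<close> and \<open>4\<close> remove \<open>g\<close> and \<open>gj\<close>.\<close>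
  have "(u - v) * ((x - y) * k) = (u - v) * ((a - b) * y * h + (b * x - a * y) * hi)"
    using 1 2 3 4 5 by algebra
  then have "(x - y) * k = (a - b) * y * h + (b * x - a * y) * hi"
    using mult_left_cancel[OF neq] by blast
  then show "(X i - X (Suc i)) * hecke_T th j (hecke_T th i f)
      = (const (inverse th) - const th) * X (Suc i) * hecke_T th j f
        + (const th * X i - const (inverse th) * X (Suc i)) * act (sref i) (hecke_T th j f)"
    by (simp add: defs)
qed

text \<open>After clearing denominators both sides are combinations of the six translates
  \<open>f\<close>, \<open>f1\<close>, \<open>f2\<close>, \<open>f12\<close>, \<open>f21\<close>,
  \<open>f121\<close> of \<open>f\<close> under the permutations of three variables. The
  intermediate values are eliminated in stages to keep each polynomial identity small.\<close>

lemma hecke_T_braid: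
  "hecke_T th i (hecke_T th (Suc i) (hecke_T th i f))
    = hecke_T th (Suc i) (hecke_T th i (hecke_T th (Suc i) f))"
proof -
  let ?s1 = "sref i" and ?s2 = "sref (Suc i)"
  define a b where "a = const (inverse th)" and "b = const th"
  define x y z where "x = X i" and "y = X (Suc i)" and "z = X (Suc (Suc i))"
  define f1 f2 where "f1 = act ?s1 f" and "f2 = act ?s2 f"
  define f12 f21 where "f12 = act ?s1 f2" and "f21 = act ?s2 f1"
  define f121 where "f121 = act ?s1 f21"
  define g p where "g = hecke_T th i f" and "p = hecke_T th (Suc i) f"
  define h q where "h = hecke_T th (Suc i) g" and "q = hecke_T th i p"
  define k r where "k = hecke_T th i h" and "r = hecke_T th (Suc i) q"
  define g1 g2 g12 h1 where "g1 = act ?s1 g" and "g2 = act ?s2 g" and "g12 = act ?s1 g2"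
    and "h1 = act ?s1 h"
  define p1 p2 p21 q2 where "p1 = act ?s1 p" and "p2 = act ?s2 p" and "p21 = act ?s2 p1"
    and "q2 = act ?s2 q"
  have s: "?s1 i = Suc i" "?s1 (Suc i) = i" "?s1 (Suc (Suc i)) = Suc (Suc i)"
    "?s2 i = i" "?s2 (Suc i) = Suc (Suc i)" "?s2 (Suc (Suc i)) = Suc i"
    by (auto simp: transpose_def)
  \<comment> \<open>The braid relation of the transpositions identifies the two translates by the
    longest element.\<close>
  have "?s2 \<circ> (?s1 \<circ> ?s2) = ?s1 \<circ> (?s2 \<circ> ?s1)" by (auto simp: fun_eq_iff transpose_def)
  then have f212: "act ?s2 f12 = f121"
    by (simp add: f121_def f12_def f21_def f1_def f2_def act_act bij_comp)
  have cc: "act ?s1 f1 = f" "act ?s2 f2 = f" by (simp_all add: f1_def f2_def)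
  have act3: "(act \<sigma> x - act \<sigma> y) * act \<sigma> (hecke_T th i e)
      = (a - b) * act \<sigma> y * act \<sigma> e + (b * act \<sigma> x - a * act \<sigma> y) * act \<sigma> (act ?s1 e)"
    "(act \<sigma> y - act \<sigma> z) * act \<sigma> (hecke_T th (Suc i) e)
      = (a - b) * act \<sigma> z * act \<sigma> e + (b * act \<sigma> y - a * act \<sigma> z) * act \<sigma> (act ?s2 e)"
    if "bij \<sigma>" for \<sigma> e
    using act_hecke_T_eq[OF that, of i th e] act_hecke_T_eq[OF that, of "Suc i" th e]
    by (simp_all add: a_def b_def x_def y_def z_def act_X that)
  have ax: "act ?s1 x = y" "act ?s1 y = x" "act ?s1 z = z"
    "act ?s2 x = x" "act ?s2 y = z" "act ?s2 z = y"
    by (simp_all add: x_def y_def z_def act_X s)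
  have e0: "(x - y) * hecke_T th i e = (a - b) * y * e + (b * x - a * y) * act ?s1 e"
    "(y - z) * hecke_T th (Suc i) e = (a - b) * z * e + (b * y - a * z) * act ?s2 e" for e
    using hecke_T_eq[of i th e] hecke_T_eq[of "Suc i" th e]
    by (simp_all add: a_def b_def x_def y_def z_def)
  have e1: "(y - x) * act ?s1 (hecke_T th i e) = (a - b) * x * act ?s1 e + (b * y - a * x) * e"
    "(x - z) * act ?s1 (hecke_T th (Suc i) e)
      = (a - b) * z * act ?s1 e + (b * x - a * z) * act ?s1 (act ?s2 e)"
    "(z - y) * act ?s2 (hecke_T th (Suc i) e) = (a - b) * y * act ?s2 e + (b * z - a * y) * e"
    "(x - z) * act ?s2 (hecke_T th i e)
      = (a - b) * z * act ?s2 e + (b * x - a * z) * act ?s2 (act ?s1 e)" for e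
    using act3[OF bij_sref, of i e] act3[OF bij_sref, of "Suc i" e] by (simp_all add: ax)
  have eg12: "(y - z) * g12 = (a - b) * z * f12 + (b * y - a * z) * f121"
    using arg_cong[OF e1(4)[of f], of "act ?s1"]
    by (simp add: act_mult act_add act_diff ax act_const a_def b_def g12_def g2_def g_def
        f12_def f2_def f121_def f21_def f1_def)
  have ep21: "(x - y) * p21 = (a - b) * y * f21 + (b * x - a * y) * f121"
    using arg_cong[OF e1(2)[of f], of "act ?s2"] f212
    by (simp add: act_mult act_add act_diff ax act_const a_def b_def p21_def p1_def p_def
        f12_def f2_def f21_def f1_def)
  have eg: "(x - y) * g = (a - b) * y * f + (b * x - a * y) * f1"
    and eg1: "(y - x) * g1 = (a - b) * x * f1 + (b * y - a * x) * f"
    and eg2: "(x - z) * g2 = (a - b) * z * f2 + (b * x - a * z) * f21"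
    and eh: "(y - z) * h = (a - b) * z * g + (b * y - a * z) * g2"
    and eh1: "(x - z) * h1 = (a - b) * z * g1 + (b * x - a * z) * g12"
    and ek: "(x - y) * k = (a - b) * y * h + (b * x - a * y) * h1"
    and ep: "(y - z) * p = (a - b) * z * f + (b * y - a * z) * f2"
    and ep1: "(x - z) * p1 = (a - b) * z * f1 + (b * x - a * z) * f12"
    and ep2: "(z - y) * p2 = (a - b) * y * f2 + (b * z - a * y) * f"
    and eq: "(x - y) * q = (a - b) * y * p + (b * x - a * y) * p1"
    and eq2: "(x - z) * q2 = (a - b) * z * p2 + (b * x - a * z) * p21"
    and er: "(y - z) * r = (a - b) * z * q + (b * y - a * z) * q2"
    using e0 e1 by (simp_all add: g_def g1_def g2_def h_def h1_def k_def g12_def p_def p1_def p2_def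
        p21_def q_def q2_def r_def f1_def f2_def f12_def f21_def)
  have nz: "x - y \<noteq> 0" "y - z \<noteq> 0" "x - z \<noteq> 0"
    by (simp_all add: x_def y_def z_def)
  have H: "(x - y) * (x - z) * (y - z) * h
      = (x - z) * (a - b) * z * ((a - b) * y * f + (b * x - a * y) * f1)
        + (x - y) * (b * y - a * z) * ((a - b) * z * f2 + (b * x - a * z) * f21)"
    using eh eg eg2 by algebra
  have H1: "(x - y) * (x - z) * (y - z) * h1
      = - (y - z) * (a - b) * z * ((a - b) * x * f1 + (b * y - a * x) * f)
        + (x - y) * (b * x - a * z) * ((a - b) * z * f12 + (b * y - a * z) * f121)"
    using eh1 eg1 eg12 by algebra
  have Q: "(x - y) * (x - z) * (y - z) * q
      = (x - z) * (a - b) * y * ((a - b) * z * f + (b * y - a * z) * f2)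
        + (y - z) * (b * x - a * y) * ((a - b) * z * f1 + (b * x - a * z) * f12)"
    using eq ep ep1 by algebra
  have Q2: "(x - y) * (x - z) * (y - z) * q2
      = - (x - y) * (a - b) * z * ((a - b) * y * f2 + (b * z - a * y) * f)
        + (y - z) * (b * x - a * z) * ((a - b) * y * f21 + (b * x - a * y) * f121)"
    using eq2 ep2 ep21 by algebra
  \<comment> \<open>\<open>k\<close> has the denominator \<open>x - y\<close> times the product of
    the three differences, \<open>r\<close> has \<open>y - z\<close> times that product;
    \<open>E\<close> is their least common multiple.\<close>
  define E where "E = (x - y) * (x - y) * ((y - z) * (y - z)) * (x - z)"
  have K: "E * k = (y - z) * ((a - b) * y * ((x - y) * (x - z) * (y - z) * h)
      + (b * x - a * y) * ((x - y) * (x - z) * (y - z) * h1))"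
    using ek unfolding E_def by algebra
  have R: "E * r = (x - y) * ((a - b) * z * ((x - y) * (x - z) * (y - z) * q)
      + (b * y - a * z) * ((x - y) * (x - z) * (y - z) * q2))"
    using er unfolding E_def by algebra
  have "E * k = E * r"
    unfolding K R H H1 Q Q2 by algebra
  moreover have "E \<noteq> 0" using nz by (simp add: E_def)
  ultimately have "k = r" by simp
  then show ?thesis by (simp add: k_def h_def g_def r_def q_def p_def)
qed

section \<open>The fermionic space\<close>

lemma hecke_T_eq_iff:
  "hecke_T th i f = h \<longleftrightarrow> (X i - X (Suc i)) * h
    = (const (inverse th) - const th) * X (Suc i) * f
      + (const th * X i - const (inverse th) * X (Suc i)) * act (sref i) f"
  using hecke_T_eqI hecke_T_eq by metis

text \<open>In the cleared equation the terms in \<open>f\<close> collect to the same factor that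
  multiplies \<open>act (sref i) f\<close>, and this factor is nonzero.\<close>

lemma bos_iff_invariant:
  assumes "th \<noteq> 0"
  shows "hecke_T th i f = const th * f \<longleftrightarrow> act (sref i) f = f"
proof -
  have nz: "const th * X i - const (inverse th) * X (Suc i) \<noteq> 0"
    using const_X_eq_iff[of i "Suc i" th] assms by simp
  have "hecke_T th i f = const th * f \<longleftrightarrow>
      (const th * X i - const (inverse th) * X (Suc i)) * f
      = (const th * X i - const (inverse th) * X (Suc i)) * act (sref i) f"
    unfolding hecke_T_eq_iff by (auto simp: algebra_simps)
  then show ?thesis using mult_left_cancel[OF nz] by metis
qed

text \<open>The two equations differ by the unit \<open>- const th\<close>, as
  \<open>a * b = 1\<close>.\<close>

lemma fer_iff:
  assumes "th \<noteq> 0"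
  shows "hecke_T th i f = - const (inverse th) * f \<longleftrightarrow>
    (X i - const (th\<^sup>2) * X (Suc i)) * f = (X (Suc i) - const (th\<^sup>2) * X i) * act (sref i) f"
proof -
  define a b where "a = const (inverse th)" and "b = const th"
  define x y g where "x = X i" and "y = X (Suc i)" and "g = act (sref i) f"
  have ab: "a * b = 1" using const_inverse_mult[OF assms] by (simp add: a_def b_def)
  have t: "const (th\<^sup>2) = b * b" by (simp add: power2_eq_square const_mult b_def)
  have "(x - y) * (- a * f) = (a - b) * y * f + (b * x - a * y) * g
      \<longleftrightarrow> (x - b * b * y) * f = (y - b * b * x) * g"
  proof
    assume "(x - y) * (- a * f) = (a - b) * y * f + (b * x - a * y) * g"
    then show "(x - b * b * y) * f = (y - b * b * x) * g" using ab by algebra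
  next
    assume "(x - b * b * y) * f = (y - b * b * x) * g"
    then show "(x - y) * (- a * f) = (a - b) * y * f + (b * x - a * y) * g" using ab by algebra
  qed
  then show ?thesis unfolding hecke_T_eq_iff t by (simp add: a_def b_def x_def y_def g_def)
qed

lemma lpoly_bos_eq_sym: "th \<noteq> 0 \<Longrightarrow> lpoly_bos th n = lpoly_sym n"
  by (simp add: lpoly_bos_def lpoly_sym_def bos_iff_invariant)

lemma mem_lpoly_fer_iff:
  assumes "th \<noteq> 0"
  shows "f \<in> lpoly_fer th n \<longleftrightarrow> f \<in> laurent n \<and> (\<forall>i\<in>{1..<n}.
    (X i - const (th\<^sup>2) * X (Suc i)) * f = (X (Suc i) - const (th\<^sup>2) * X i) * act (sref i) f)"
  unfolding lpoly_fer_def using fer_iff[OF assms] by simp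

text \<open>For \<open>th = 1\<close> the fermionic equation is antisymmetry multiplied by
  \<open>X i - X (Suc i)\<close>; the determinant isomorphism thereby becomes an instance of the
  fermionic one.\<close>

lemma lpoly_det_eq_fer: "lpoly_det n = lpoly_fer 1 n"
proof -
  have "act (sref i) f = - f \<longleftrightarrow> (X i - X (Suc i)) * f = (X (Suc i) - X i) * act (sref i) f" for i f
  proof -
    have "(X i - X (Suc i)) * f = (X (Suc i) - X i) * act (sref i) f
        \<longleftrightarrow> (X i - X (Suc i)) * act (sref i) f = (X i - X (Suc i)) * (- f)"
      by (auto simp: algebra_simps)
    moreover have "X i - X (Suc i) \<noteq> 0" by simp
    ultimately show ?thesis using mult_left_cancel by blast
  qed
  then show ?thesis by (auto simp: lpoly_det_def mem_lpoly_fer_iff)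
qed

section \<open>The product \<open>A_rho\<close>\<close>

lemma a_rho_eq_A_rho: "a_rho n = A_rho 1 n"
  by (simp add: a_rho_def A_rho_def)

lemma finite_pairs: "finite {(i, j). 1 \<le> i \<and> i < j \<and> j \<le> n}" for n :: nat
  by (rule finite_subset[of _ "{1..n} \<times> {1..n}"]) auto

lemma X_neq_const_X: "i \<noteq> j \<Longrightarrow> X j \<noteq> const t * X i"
  using const_X_eq_iff[of j i 1 t] by simp

lemma A_rho_neq_0: "A_rho t n \<noteq> 0"
  unfolding A_rho_def using finite_pairs[of n] by (auto simp: X_neq_const_X)

lemma act_A_rho:
  assumes "bij \<sigma>"
  shows "act \<sigma> (A_rho t n)
    = (\<Prod>(i, j) | 1 \<le> i \<and> i < j \<and> j \<le> n. X (\<sigma> j) - const t * X (\<sigma> i))"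
  unfolding A_rho_def lpoly_hom.hom_prod[OF lpoly_hom_act[OF assms]]
  by (rule prod.cong)
    (auto simp: act_diff[OF assms] act_mult[OF assms] act_const[OF assms] act_X[OF assms])

text \<open>The transposition permutes all factors except that of \<open>(i, Suc i)\<close>, whose
  two variables it exchanges; this factor alone accounts for the equation.\<close>

lemma A_rho_fer:
  assumes "th \<noteq> 0"
  shows "A_rho (th\<^sup>2) n \<in> lpoly_fer th n"
  unfolding mem_lpoly_fer_iff[OF assms]
proof (intro conjI ballI)
  show "A_rho (th\<^sup>2) n \<in> laurent n"
    unfolding A_rho_def
    by (rule laurent_prod) (auto intro!: laurent_diff laurent_mult laurent_X)
next
  fix i assume i: "i \<in> {1..<n}"
  let ?S = "{(i, j). 1 \<le> i \<and> i < j \<and> j \<le> n}"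
  let ?S' = "?S - {(i, Suc i)}"
  define p where "p = (\<lambda>(k, l). X l - const (th\<^sup>2) * X k)"
  have mem: "(i, Suc i) \<in> ?S" using i by auto
  have A: "A_rho (th\<^sup>2) n = p (i, Suc i) * prod p ?S'"
    unfolding A_rho_def p_def[symmetric] by (rule prod.remove[OF finite_pairs mem])
  have "act (sref i) (A_rho (th\<^sup>2) n) = prod (\<lambda>x. p (map_prod (sref i) (sref i) x)) ?S"
    unfolding act_A_rho[OF bij_sref] by (rule prod.cong) (auto simp: p_def)
  also have "\<dots> = p (Suc i, i) * prod (\<lambda>x. p (map_prod (sref i) (sref i) x)) ?S'"
    by (subst prod.remove[OF finite_pairs mem]) simp
  also have "prod (\<lambda>x. p (map_prod (sref i) (sref i) x)) ?S' = prod p ?S'"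
  proof (rule prod.reindex_bij_witness[of _ "map_prod (sref i) (sref i)" "map_prod (sref i) (sref i)"])
    show "map_prod (sref i) (sref i) (map_prod (sref i) (sref i) x) = x" for x
      by (cases x) simp
    then show "map_prod (sref i) (sref i) (map_prod (sref i) (sref i) x) = x" for x .
    show "map_prod (sref i) (sref i) x \<in> ?S'" if "x \<in> ?S'" for x
      using that i by (cases x) (auto simp: transpose_def split: if_splits)
    then show "map_prod (sref i) (sref i) x \<in> ?S'" if "x \<in> ?S'" for x using that .
  qed simp
  finally show "(X i - const (th\<^sup>2) * X (Suc i)) * A_rho (th\<^sup>2) n
      = (X (Suc i) - const (th\<^sup>2) * X i) * act (sref i) (A_rho (th\<^sup>2) n)"
    unfolding A by (simp add: p_def mult_ac)
qed

text \<open>In the fraction field this says that \<open>f / A\<close> is invariant.\<close>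

lemma fer_mult_act:
  assumes th: "th \<noteq> 0" and f: "f \<in> lpoly_fer th n" and A: "A \<in> lpoly_fer th n" "A \<noteq> 0"
    and w: "set is \<subseteq> {1..<n}"
  shows "f * act (word_perm is) A = A * act (word_perm is) f"
  using w
proof (induction "is")
  case (Cons i "is")
  let ?w = "word_perm is" and ?s = "act (sref i)"
  have i: "i \<in> {1..<n}" using Cons.prems by simp
  define x y where "x = X i - const (th\<^sup>2) * X (Suc i)" and "y = X (Suc i) - const (th\<^sup>2) * X i"
  have nz: "x \<noteq> 0" "y \<noteq> 0" by (simp_all add: x_def y_def X_neq_const_X)
  have fA: "x * f = y * ?s f" "x * A = y * ?s A"
    using f A i by (auto simp: mem_lpoly_fer_iff[OF th] x_def y_def)
  have "bij ?w" using Cons.prems word_perm_permutes[of "is" n] by (simp add: permutes_bij)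
  then have act: "act (word_perm (i # is)) g = ?s (act ?w g)" for g
    by (simp add: act_act)
  have sA: "?s A \<noteq> 0" using A by (simp add: act_eq_0_iff)
  have "?s f * ?s (act ?w A) = ?s A * ?s (act ?w f)"
    using Cons by (simp flip: act_mult)
  \<comment> \<open>Both sides equal \<open>y * y * ?s A * ?s A * ?s (act ?w f)\<close>.\<close>
  then have "x * y * ?s A * (f * ?s (act ?w A)) = x * y * ?s A * (A * ?s (act ?w f))"
    using fA by algebra
  then show ?case unfolding act using nz sA by simp
qed (simp add: act_id)

section \<open>Divisibility of fermionic elements by \<open>A_rho\<close>\<close>

lemma adjacent_factor_dvd_fer:
  assumes th: "th \<noteq> 0" "th\<^sup>2 \<noteq> - 1" and f: "f \<in> lpoly_fer th n" and i: "i \<in> {1..<n}"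
  shows "X (Suc i) - const (th\<^sup>2) * X i dvd f"
proof -
  let ?t = "th\<^sup>2"
  let ?h = "identify ?t i (Suc i)"
  have t: "?t \<noteq> 0" using th by simp
  interpret lpoly_hom ?h using t by (rule lpoly_hom_identify)
  have eq: "(X i - const ?t * X (Suc i)) * f = (X (Suc i) - const ?t * X i) * act (sref i) f"
    using f i by (simp add: mem_lpoly_fer_iff[OF th(1)])
  have "?h f = 0"
  proof (cases "?t = 1")
    case False
    \<comment> \<open>The substitution annihilates the factor
      \<open>X (Suc i) - const ?t * X i\<close> on the right and leaves
      \<open>const (1 - ?t * ?t) * X i * ?h f\<close> on the left.\<close>
    have "(X i - const ?t * (const ?t * X i)) * ?h f = 0"
      using arg_cong[OF eq, of ?h] by (simp add: hom_mult hom_diff hom_const identify_X)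
    moreover have "X i - const ?t * (const ?t * X i) = const (1 - ?t * ?t) * X i"
      unfolding const_diff const_mult const_1 by algebra
    moreover have "1 - ?t * ?t \<noteq> 0" using False th(2) by (metis power2_eq_1_iff power2_eq_square right_minus_eq)
    ultimately show ?thesis by simp
  next
    case True
    \<comment> \<open>For \<open>?t = 1\<close> the substituted equation is trivial, so the factor
      \<open>X i - X (Suc i)\<close> is cancelled first; \<open>f\<close> is then antisymmetric,
      while \<open>?h\<close> does not distinguish \<open>f\<close> from its reflection.\<close>
    have "(X i - X (Suc i)) * f = (X i - X (Suc i)) * (- act (sref i) f)"
      using eq True by (simp add: algebra_simps)
    moreover have "X i - X (Suc i) \<noteq> 0" by simp
    ultimately have anti: "f = - act (sref i) f" using mult_left_cancel by blast
    have "?h (act (sref i) f) = ?h f"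
      by (rule lpoly_hom_eqI[OF lpoly_hom_comp[OF lpoly_hom_axioms lpoly_hom_act[OF bij_sref]] lpoly_hom_axioms])
        (auto simp: act_X identify_X True transpose_def)
    then have "?h f = - ?h f" using anti by (metis hom_minus)
    then have "const 2 * ?h f = 0" using const_add[of 1 1] by (simp add: eq_neg_iff_add_eq_0)
    then show ?thesis by simp
  qed
  then show ?thesis using dvd_iff_identify[OF t, of i "Suc i" f] by simp
qed

text \<open>What remains is a combination of two distinct variables. The pair \<open>(j, i)\<close>
  is excluded since its factor becomes \<open>const (1 - t * t) * X i\<close>, which vanishes for t
  = 1.\<close>

lemma identify_factor_neq_0:
  assumes "t \<noteq> 0" "k \<noteq> l" "(k, l) \<noteq> (i, j)" "(k, l) \<noteq> (j, i)"
  shows "identify t i j (X l - const t * X k) \<noteq> 0"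
proof -
  interpret lpoly_hom "identify t i j" using assms(1) by (rule lpoly_hom_identify)
  have e: "identify t i j (X l - const t * X k) = (if l = j then const t * X i else X l)
      - (if k = j then const (t * t) * X i else const t * X k)"
    by (simp add: hom_diff hom_mult hom_const identify_X const_mult mult.assoc)
  show ?thesis
    unfolding e using assms const_X_eq_iff[of l k 1 t] const_X_eq_iff[of l i 1 "t * t"]
      const_X_eq_iff[of i k t t] by auto
qed

text \<open>Each \<open>p s\<close> is prime, being the generator of a kernel, and no other factor
  lies in this kernel; so \<open>p s\<close> divides what remains after the other factors have been
  divided out.\<close>

lemma prod_dvd_if_kernels:
  fixes p :: "'b \<Rightarrow> lpoly"
  assumes "finite S" and "\<And>s. s \<in> S \<Longrightarrow> lpoly_hom (h s)"
    and ker: "\<And>s g. s \<in> S \<Longrightarrow> p s dvd g \<longleftrightarrow> h s g = 0"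
    and "\<And>s u. s \<in> S \<Longrightarrow> u \<in> S \<Longrightarrow> s \<noteq> u \<Longrightarrow> h s (p u) \<noteq> 0"
    and "\<And>s. s \<in> S \<Longrightarrow> p s dvd f"
  shows "prod p S dvd f"
  using assms
proof (induction S)
  case (insert s S)
  have "prod p S dvd f" by (rule insert.IH) (use insert.prems in auto)
  then obtain g where g: "f = prod p S * g" by (rule dvdE)
  interpret lpoly_hom "h s" using insert.prems(1) by simp
  have "h s f = 0" using insert.prems(2,4) by blast
  moreover have "h s (prod p S) \<noteq> 0"
    unfolding hom_prod using insert.prems(3)[of s] insert.hyps by auto
  ultimately have "h s g = 0" unfolding g hom_mult by simp
  then have "p s dvd g" using insert.prems(2) by blast
  then show ?case unfolding g using insert.hyps by (simp add: mult.commute mult_dvd_mono)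
qed simp

lemma factor_dvd_fer:
  assumes th: "th \<noteq> 0" "th\<^sup>2 \<noteq> - 1" and f: "f \<in> lpoly_fer th n"
    and ij: "1 \<le> i" "i < j" "j \<le> n"
  shows "X j - const (th\<^sup>2) * X i dvd f"
proof -
  let ?t = "th\<^sup>2"
  let ?S = "{(i, j). 1 \<le> i \<and> i < j \<and> j \<le> n}"
  let ?p = "X j - const ?t * X i"
  have t: "?t \<noteq> 0" using th by simp
  \<comment> \<open>Carries the adjacent pair \<open>(1, 2)\<close> to \<open>(i, j)\<close>; since
    \<open>j\<close> is neither 1 nor \<open>i\<close>, it is fixed by
    \<open>transpose 1 i\<close>.\<close>
  define w where "w = transpose 1 i \<circ> transpose 2 j"
  have w12: "w 1 = i" "w 2 = j" using ij by (auto simp: w_def transpose_def)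
  have w: "w permutes {1..n}"
    unfolding w_def using ij by (intro permutes_compose permutes_swap_id) auto
  have bw: "bij w" using w by (rule permutes_bij)
  have inj: "w k = w l \<longleftrightarrow> k = l" for k l using permutes_inj[OF w] by (simp add: inj_eq)
  obtain "is" where "is": "set is \<subseteq> {1..<n}" "word_perm is = w"
    using ex_word_of_length_ninv[OF w] by blast
  have swap: "f * act w (A_rho ?t n) = A_rho ?t n * act w f"
    using fer_mult_act[OF th(1) f A_rho_fer[OF th(1)] A_rho_neq_0 "is"(1)] "is"(2) by simp
  have "X (Suc 1) - const ?t * X 1 dvd f"
    by (rule adjacent_factor_dvd_fer[OF th f]) (use ij in auto)
  then obtain g where "f = (X 2 - const ?t * X 1) * g" by (auto elim: dvdE simp: numeral_2_eq_2 One_nat_def)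
  then have wf: "act w f = ?p * act w g"
    by (simp add: act_mult[OF bw] act_diff[OF bw] act_const[OF bw] act_X[OF bw] w12)
  define q where "q = (\<lambda>(k, l). X (w l) - const ?t * X (w k))"
  have wA: "act w (A_rho ?t n) = ?p * prod q (?S - {(1, 2)})"
    unfolding act_A_rho[OF bw] q_def[symmetric]
    by (subst prod.remove[OF finite_pairs, of "(1, 2)"]) (use ij in \<open>auto simp: q_def w12\<close>)
  obtain A' where A: "A_rho ?t n = ?p * A'"
    unfolding A_rho_def
    using prod.remove[OF finite_pairs, of "(i, j)" n "\<lambda>(k, l). X l - const ?t * X k"] ij by auto
  \<comment> \<open>\<open>?p\<close> occurs once on the left, from \<open>wA\<close>, and twice on
    the right, from \<open>A\<close> and \<open>wf\<close>; after cancelling one copy it still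
    divides the right side.\<close>
  have "?p * (f * prod q (?S - {(1, 2)})) = ?p * (?p * (A' * act w g))"
    using swap unfolding wA wf unfolding A by (simp only: mult_ac)
  moreover have "?p \<noteq> 0" using ij X_neq_const_X[of i j] by simp
  ultimately have *: "f * prod q (?S - {(1, 2)}) = ?p * (A' * act w g)"
    using mult_left_cancel by blast
  interpret lpoly_hom "identify ?t i j" using t by (rule lpoly_hom_identify)
  have ker: "?p dvd h \<longleftrightarrow> identify ?t i j h = 0" for h
    using dvd_iff_identify[OF t] ij by simp
  have "?p dvd f * prod q (?S - {(1, 2)})" unfolding * by (rule dvd_triv_left)
  then have "identify ?t i j f * identify ?t i j (prod q (?S - {(1, 2)})) = 0"
    unfolding ker hom_mult .
  \<comment> \<open>As \<open>w\<close> is injective, only \<open>(1, 2)\<close> goes to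
    \<open>(i, j)\<close>, and only \<open>(2, 1)\<close>, which is not in \<open>?S\<close>, goes
    to \<open>(j, i)\<close>.\<close>
  moreover have "identify ?t i j (prod q (?S - {(1, 2)})) \<noteq> 0"
  proof -
    have "identify ?t i j (q (k, l)) \<noteq> 0" if "(k, l) \<in> ?S - {(1, 2)}" for k l
      unfolding q_def prod.case
      by (rule identify_factor_neq_0[OF t]) (use that inj w12 in auto)
    then show ?thesis unfolding hom_prod using finite_pairs[of n] by auto
  qed
  ultimately show ?thesis using ker by simp
qed

lemma A_rho_dvd_fer:
  assumes th: "th \<noteq> 0" "th\<^sup>2 \<noteq> - 1" and f: "f \<in> lpoly_fer th n"
  shows "A_rho (th\<^sup>2) n dvd f"
  unfolding A_rho_def
proof (rule prod_dvd_if_kernels[where h = "\<lambda>(i, j). identify (th\<^sup>2) i j"])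
  have t: "th\<^sup>2 \<noteq> 0" using th by simp
  show "lpoly_hom (case s of (i, j) \<Rightarrow> identify (th\<^sup>2) i j)" for s
    using lpoly_hom_identify[OF t] by (auto split: prod.split)
  show "(case s of (i, j) \<Rightarrow> X j - const (th\<^sup>2) * X i) dvd g \<longleftrightarrow>
      (case s of (i, j) \<Rightarrow> identify (th\<^sup>2) i j) g = 0" if "s \<in> {(i, j). 1 \<le> i \<and> i < j \<and> j \<le> n}" for s g
    using that dvd_iff_identify[OF t] by (auto split: prod.split)
  show "(case s of (i, j) \<Rightarrow> identify (th\<^sup>2) i j) (case u of (i, j) \<Rightarrow> X j - const (th\<^sup>2) * X i) \<noteq> 0"
    if "s \<in> {(i, j). 1 \<le> i \<and> i < j \<and> j \<le> n}" "u \<in> {(i, j). 1 \<le> i \<and> i < j \<and> j \<le> n}" "s \<noteq> u" for s u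
  proof -
    obtain i j k l where "s = (i, j)" "u = (k, l)" by fastforce
    then show ?thesis using that identify_factor_neq_0[OF t, of k l i j] by auto
  qed
  show "(case s of (i, j) \<Rightarrow> X j - const (th\<^sup>2) * X i) dvd f"
    if "s \<in> {(i, j). 1 \<le> i \<and> i < j \<and> j \<le> n}" for s
    using that factor_dvd_fer[OF th f] by (auto split: prod.split)
qed (rule finite_pairs)

text \<open>\<open>f\<close> and \<open>A_rho\<close> satisfy the same exchange equation, so their
  quotient is invariant, and conversely. For \<open>n < 2\<close> the product is empty, and t = -1
  is harmless.\<close>

lemma lpoly_fer_eq_image:
  assumes th: "th \<noteq> 0" "n < 2 \<or> th\<^sup>2 \<noteq> - 1"
  shows "lpoly_fer th n = (\<lambda>f. A_rho (th\<^sup>2) n * f) ` lpoly_sym n"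
proof (intro equalityI subsetI)
  let ?A = "A_rho (th\<^sup>2) n"
  have A: "?A \<in> laurent n" "?A \<noteq> 0"
    using A_rho_fer[OF th(1)] A_rho_neq_0 by (auto simp: lpoly_fer_def)
  have A_eq: "(X i - const (th\<^sup>2) * X (Suc i)) * ?A = (X (Suc i) - const (th\<^sup>2) * X i) * act (sref i) ?A"
    if "i \<in> {1..<n}" for i
    using A_rho_fer[OF th(1), of n] that by (simp add: mem_lpoly_fer_iff[OF th(1)])
  {
    fix f assume f: "f \<in> lpoly_fer th n"
    have "?A dvd f"
    proof (cases "n < 2")
      case True
      then have "{(i, j). 1 \<le> i \<and> i < j \<and> j \<le> n} = {}" by auto
      then show ?thesis by (simp only: A_rho_def prod.empty one_dvd)
    qed (use th A_rho_dvd_fer f in blast)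
    then obtain h where h: "f = ?A * h" by (rule dvdE)
    have "h \<in> laurent n"
      by (rule laurent_cancel[OF A]) (use f h in \<open>auto simp: lpoly_fer_def\<close>)
    moreover have "act (sref i) h = h" if i: "i \<in> {1..<n}" for i
    proof -
      let ?x = "X i - const (th\<^sup>2) * X (Suc i)"
      have "?x * (?A * h) = (X (Suc i) - const (th\<^sup>2) * X i) * act (sref i) (?A * h)"
        using f i h by (simp add: mem_lpoly_fer_iff[OF th(1)])
      also have "\<dots> = ?x * ?A * act (sref i) h"
        unfolding A_eq[OF i] by (simp add: act_mult mult.assoc)
      finally have "?x * ?A * h = ?x * ?A * act (sref i) h" by (simp only: mult.assoc)
      moreover have "?x * ?A \<noteq> 0"
        using A X_neq_const_X[of "Suc i" i] by simp
      ultimately show ?thesis using mult_left_cancel by metis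
    qed
    ultimately show "f \<in> (\<lambda>f. ?A * f) ` lpoly_sym n" using h by (auto simp: lpoly_sym_def)
  next
    fix f assume "f \<in> (\<lambda>f. ?A * f) ` lpoly_sym n"
    then obtain h where h: "h \<in> lpoly_sym n" "f = ?A * h" by blast
    have "f \<in> laurent n" using h A by (simp add: lpoly_sym_def laurent_mult)
    moreover have "(X i - const (th\<^sup>2) * X (Suc i)) * f
        = (X (Suc i) - const (th\<^sup>2) * X i) * act (sref i) f" if i: "i \<in> {1..<n}" for i
    proof -
      have "act (sref i) f = act (sref i) ?A * h" using h i by (simp add: act_mult lpoly_sym_def)
      then show ?thesis using A_eq[OF i] h(2) by (simp flip: mult.assoc)
    qed
    ultimately show "f \<in> lpoly_fer th n" by (simp add: mem_lpoly_fer_iff[OF th(1)])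
  }
qed

section \<open>Symmetrizers\<close>

lemma T_word_simps [simp]:
  "T_word th [] f = f" "T_word th (i # is) f = hecke_T th i (T_word th is f)"
  by (simp_all add: T_word_def)

text \<open>The arbitrary choice in \<open>T_perm\<close> is harmless: the commutation and braid
  relations make Matsumoto's theorem applicable.\<close>

lemma T_perm_reduced:
  assumes "reduced_word n w u"
  shows "T_perm th n w = T_word th u"
proof -
  have "reduced_word n w (SOME u. reduced_word n w u)" using assms by (rule someI)
  then show ?thesis
    unfolding T_perm_def T_word_def
    by (intro matsumoto[of "hecke_T th", OF _ _ _ assms])
      (auto simp: fun_eq_iff hecke_T_braid intro: hecke_T_commute)
qed

lemma T_perm_ascent:
  assumes w: "w permutes {1..n}" and i: "i \<in> {1..<n}" and asc: "inv w i < inv w (Suc i)"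
  shows "T_perm th n (sref i \<circ> w) f = hecke_T th i (T_perm th n w f)"
proof -
  obtain u where u: "reduced_word n w u" using ex_reduced_word[OF w] by blast
  have "reduced_word n (sref i \<circ> w) (i # u)"
  proof (rule reduced_word_Cons[OF sref_comp_permutes[OF i w] i])
    show "inv (sref i \<circ> w) (Suc i) < inv (sref i \<circ> w) i"
      using asc by (simp add: inv_sref_comp[OF w])
    show "reduced_word n (sref i \<circ> (sref i \<circ> w)) u" unfolding sref_sref_comp by (rule u)
  qed
  then show ?thesis by (simp add: T_perm_reduced[OF u] T_perm_reduced)
qed

lemma laurent_T_perm:
  assumes w: "w permutes {1..n}" and f: "f \<in> laurent n"
  shows "T_perm th n w f \<in> laurent n"
proof -
  obtain u where u: "reduced_word n w u" using ex_reduced_word[OF w] by blast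
  have "set u \<subseteq> {1..<n} \<Longrightarrow> T_word th u f \<in> laurent n"
    by (induction u) (use f in \<open>auto intro: laurent_hecke_T\<close>)
  then show ?thesis using u by (simp add: T_perm_reduced reduced_word_def)
qed

lemma T_perm_eigenvector:
  assumes w: "w permutes {1..n}" and f: "\<And>i. i \<in> {1..<n} \<Longrightarrow> hecke_T th i f = const c * f"
  shows "T_perm th n w f = const (c ^ perm_length n w) * f"
proof -
  obtain u where u: "reduced_word n w u" using ex_reduced_word[OF w] by blast
  have "set u \<subseteq> {1..<n} \<Longrightarrow> T_word th u f = const (c ^ length u) * f"
    by (induction u) (simp_all add: f hecke_T_const_mult const_mult mult.assoc mult.left_commute[of "const c"])
  then show ?thesis using u by (simp add: T_perm_reduced reduced_word_def)
qed

text \<open>Both symmetrizers are of this form, for the two eigenvalues \<open>c = th\<close> and \<open>c = - 1 / th\<close>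
  of the operators.  Grouping \<open>w\<close> with \<open>sref i \<circ> w\<close> shows that the image consists of eigenvectors;
  on eigenvectors the sum is multiplication by the Poincare polynomial at \<open>c\<^sup>2\<close>, up to a unit.\<close>

lemma image_symmetrizer:
  fixes c th :: complex and N :: int
  assumes th: "th \<noteq> 0" and c: "c = th \<or> c = - inverse th" and P: "poincare n (c\<^sup>2) \<noteq> 0"
  shows "(\<lambda>f. \<Sum>w | w permutes {1..n}.
      const (c powi (int (perm_length n w) - N)) * T_perm th n w f) ` laurent n
    = {f \<in> laurent n. \<forall>i\<in>{1..<n}. hecke_T th i f = const c * f}"
    (is "?S ` _ = ?E")
proof (intro equalityI subsetI)
  have c0: "c \<noteq> 0" using c th by auto
  fix g assume "g \<in> ?S ` laurent n"
  then obtain f where f: "f \<in> laurent n" and g: "g = ?S f" by blast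
  have "g \<in> laurent n"
    unfolding g by (intro laurent_sum laurent_mult laurent_const laurent_T_perm f) simp
  moreover have "hecke_T th i g = const c * g" if i: "i \<in> {1..<n}" for i
  proof -
    let ?W = "{w. w permutes {1..n} \<and> inv w i < inv w (Suc i)}"
    let ?e = "\<lambda>w. const (c powi (int (perm_length n w) - N))"
    let ?u = "\<lambda>w. T_perm th n w f + const c * hecke_T th i (T_perm th n w f)"
    \<comment> \<open>\<open>c\<close> is a root of the quadratic relation, which makes
      \<open>h + const c * hecke_T th i h\<close> an eigenvector for every \<open>h\<close>.\<close>
    have "c * c = (th - inverse th) * c + 1" using c th by (auto simp: algebra_simps)
    then have cc: "const c * const c = (const th - const (inverse th)) * const c + 1"
      by (simp flip: const_mult const_diff const_1 const_add)
    have eig: "hecke_T th i (h + const c * hecke_T th i h)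
        = const c * (h + const c * hecke_T th i h)" for h
      unfolding hecke_T_add hecke_T_const_mult hecke_T_quadratic[OF th] using cc by algebra
    have "g = (\<Sum>w\<in>?W. ?e w * T_perm th n w f + ?e (sref i \<circ> w) * T_perm th n (sref i \<circ> w) f)"
      unfolding g by (rule sum_permutes_pairs[OF i])
    also have "\<dots> = (\<Sum>w\<in>?W. ?e w * ?u w)"
    proof (rule sum.cong)
      fix w assume "w \<in> ?W"
      then have w: "w permutes {1..n}" "inv w i < inv w (Suc i)" by auto
      have "int (perm_length n (sref i \<circ> w)) - N = 1 + (int (perm_length n w) - N)"
        using perm_length_ascent[OF w(1) i w(2)] by simp
      then have "?e (sref i \<circ> w) = const c * ?e w"
        by (simp only: power_int_add[OF disjI1[OF c0]] power_int_1_right const_mult)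
      then show "?e w * T_perm th n w f + ?e (sref i \<circ> w) * T_perm th n (sref i \<circ> w) f = ?e w * ?u w"
        unfolding T_perm_ascent[OF w(1) i w(2)] by (simp add: distrib_left mult_ac)
    qed simp
    finally have *: "g = (\<Sum>w\<in>?W. ?e w * ?u w)" .
    show ?thesis
      unfolding * hecke_T_sum hecke_T_const_mult eig sum_distrib_left by (simp add: mult_ac)
  qed
  ultimately show "g \<in> ?E" by blast
next
  have c0: "c \<noteq> 0" using c th by auto
  fix f assume f: "f \<in> ?E"
  \<comment> \<open>The scalar by which the sum acts on eigenvectors; the preimage of
    \<open>f\<close> is \<open>f\<close> divided by it.\<close>
  define u where "u = c powi (- N) * poincare n (c\<^sup>2)"
  have u0: "u \<noteq> 0" using P c0 by (simp add: u_def)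
  define f' where "f' = const (inverse u) * f"
  have f': "f' \<in> laurent n" "\<And>i. i \<in> {1..<n} \<Longrightarrow> hecke_T th i f' = const c * f'"
    using f by (auto simp: f'_def laurent_mult hecke_T_const_mult)
  have "?S f' = (\<Sum>w | w permutes {1..n}. const (c powi (- N) * (c\<^sup>2) ^ perm_length n w) * f')"
  proof (rule sum.cong)
    fix w assume "w \<in> {w. w permutes {1..n}}"
    then have "w permutes {1..n}" by simp
    note T_perm_eigenvector[OF this f'(2)]
    moreover have "c powi (int (perm_length n w) - N) * c ^ perm_length n w
        = c powi (- N) * (c\<^sup>2) ^ perm_length n w"
      using c0 power_int_add[of c "- N" "int (perm_length n w)"]
      by (simp add: power2_eq_square power_mult_distrib)
    ultimately show "const (c powi (int (perm_length n w) - N)) * T_perm th n w f'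
        = const (c powi (- N) * (c\<^sup>2) ^ perm_length n w) * f'"
      by (simp flip: mult.assoc const_mult)
  qed simp
  also have "\<dots> = const u * f'"
    by (simp add: u_def poincare_def sum_distrib_left const_sum flip: sum_distrib_right)
  also have "\<dots> = f" using u0 by (simp add: f'_def flip: mult.assoc const_mult)
  finally have "f = ?S f'" by (rule sym)
  then show "f \<in> ?S ` laurent n" using f'(1) by (rule image_eqI)
qed

section \<open>Module isomorphisms\<close>

lemma submodule_lpoly_sym: "submodule_over (lpoly_sym n) (lpoly_sym n)"
  unfolding submodule_over_def lpoly_sym_def
  by (auto simp: laurent_add laurent_minus laurent_mult act_add act_mult
      lpoly_hom.hom_minus[OF lpoly_hom_act])

text \<open>Multiplication by a nonzero element of a domain is injective and
  \<open>R\<close>-linear; so each isomorphism follows once its target is identified as such an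
  image.\<close>

lemma module_iso_mult:
  fixes a :: "'a::idom"
  assumes "submodule_over R M" "a \<noteq> 0"
  shows "module_iso R M ((\<lambda>f. a * f) ` M) (\<lambda>f. a * f)"
proof -
  have "submodule_over R ((\<lambda>f. a * f) ` M)"
    unfolding submodule_over_def
  proof (intro conjI ballI)
    note M = assms(1)[unfolded submodule_over_def]
    show "0 \<in> (\<lambda>f. a * f) ` M" using M by (intro image_eqI[of _ _ 0]) auto
    fix f assume "f \<in> (\<lambda>f. a * f) ` M"
    then obtain f' where f: "f' \<in> M" "f = a * f'" by blast
    show "- f \<in> (\<lambda>f. a * f) ` M" using M f by (intro image_eqI[of _ _ "- f'"]) auto
    show "r * f \<in> (\<lambda>f. a * f) ` M" if "r \<in> R" for r
      using M f that by (intro image_eqI[of _ _ "r * f'"]) auto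
    fix g assume "g \<in> (\<lambda>f. a * f) ` M"
    then obtain g' where g: "g' \<in> M" "g = a * g'" by blast
    show "f + g \<in> (\<lambda>f. a * f) ` M"
      using M f g by (intro image_eqI[of _ _ "f' + g'"]) (auto simp: distrib_left)
  qed
  then show ?thesis
    using assms by (auto simp: module_iso_def bij_betw_def inj_on_def distrib_left mult_ac)
qed

theorem theorem4p4:
  fixes n :: nat and q th :: complex
  assumes "n > 0" and "q \<noteq> 0" and "th \<noteq> 0"
    and "poincare n (th\<^sup>2) \<noteq> 0"
  shows "bos_symmetrizer th n ` laurent n = lpoly_bos th n \<and> lpoly_bos th n = lpoly_sym n
    \<and> fer_symmetrizer th n ` laurent n = lpoly_fer th n
    \<and> lpoly_fer th n = (\<lambda>f. A_rho (th\<^sup>2) n * f) ` lpoly_sym n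
    \<and> module_iso (lpoly_sym n) (lpoly_sym n) (lpoly_det n) (\<lambda>f. a_rho n * f)
    \<and> module_iso (lpoly_sym n) (lpoly_bos th n) (lpoly_fer th n) (\<lambda>f. A_rho (th\<^sup>2) n * f)"
proof -
  note th = assms(3)
  have t: "n < 2 \<or> th\<^sup>2 \<noteq> - 1" using poincare_neg_one assms(4) by (metis not_less)
  have bos: "bos_symmetrizer th n ` laurent n = lpoly_bos th n"
    unfolding bos_symmetrizer_def lpoly_bos_def
    by (rule image_symmetrizer[OF th]) (use assms in auto)
  have "poincare n ((- inverse th)\<^sup>2) \<noteq> 0"
    using poincare_inverse_nonzero[OF assms(4)] th by (simp add: power_inverse)
  then have fer: "fer_symmetrizer th n ` laurent n = lpoly_fer th n"
    unfolding fer_symmetrizer_def lpoly_fer_def const_minus[symmetric]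
    by (intro image_symmetrizer[OF th]) auto
  have fer_eq: "lpoly_fer th n = (\<lambda>f. A_rho (th\<^sup>2) n * f) ` lpoly_sym n"
    by (rule lpoly_fer_eq_image[OF th t])
  have det_eq: "lpoly_det n = (\<lambda>f. a_rho n * f) ` lpoly_sym n"
    using lpoly_fer_eq_image[of 1 n] by (simp add: lpoly_det_eq_fer a_rho_eq_A_rho)
  have "module_iso (lpoly_sym n) (lpoly_sym n) (lpoly_det n) (\<lambda>f. a_rho n * f)"
    unfolding det_eq a_rho_eq_A_rho by (rule module_iso_mult[OF submodule_lpoly_sym A_rho_neq_0])
  moreover have "module_iso (lpoly_sym n) (lpoly_bos th n) (lpoly_fer th n) (\<lambda>f. A_rho (th\<^sup>2) n * f)"
    unfolding fer_eq lpoly_bos_eq_sym[OF th]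
    by (rule module_iso_mult[OF submodule_lpoly_sym A_rho_neq_0])
  ultimately show ?thesis using bos fer fer_eq lpoly_bos_eq_sym[OF th] by blast
qed

end
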